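(* Let $p$ be a mixture of $k$ centered/symmetric log-concave distributions on $\mathbb{R}$, let $\mu\in\mathbb{R}$, and let $X_1,\dots,X_n$ be i.i.d. samples from $p_\mu$. Let $\delta\in(0,1)$. Consider the following estimator with testing parameter $\gamma\ge 0$: for $l\le r$ let $\rho(l,r)$ be the number of samples lying in $[l,r]$; for $\hat\mu\in\mathbb{R}$ and $0\le a<b$, the test $\mathrm{Test}(\hat\mu,a,b,\gamma)$ FAILS if $\left|\sqrt{\rho(\hat\mu-b,\hat\mu-a)}-\sqrt{\rho(\hat\mu+a,\hat\mu+b)}\right|>\gamma$ and PASSES otherwise; the estimator outputs any $\hat\mu$ that passes $\mathrm{Test}(\hat\mu,a,b,\gamma)$ for all $0\le a<b$. Then there exist universal constants $C_\gamma,C_{\mathrm{dist}}\ge1$ such that, setting \[ \Delta^*=\omega_p\!\left(C_{\mathrm{dist}}\cdot\frac{k}{n}\cdot\log(2n/\delta)\cdot\log^2(2n)\right), \] with probability at least $1-\delta$ the output $\hat\mu$ of this estimator with $\gamma=C_\gamma\sqrt{\log(2n/\delta)}$ satisfies $|\mu-\hat\mu|\le\Delta^*/2$.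
   Context: A mixture of $k$ centered/symmetric log-concave distributions is a density $p=\sum_{i=1}^k w_ip_i$ on $\mathbb{R}$ with $w_i\ge0$, $\sum_iw_i=1$, and each $p_i$ a log-concave density (of the form $e^{-V}$ with $V$ convex) symmetric about $0$. For $\mu\in\mathbb{R}$, $p_\mu(x)=p(x-\mu)$. The squared Hellinger distance is $d_h^2(f,g)=\frac12\int(\sqrt{f(x)}-\sqrt{g(x)})^2\,dx$. The Hellinger modulus of $p$ is $\omega_p(\varepsilon)=\sup\{|\Delta|:\ d_h^2(p,p_\Delta)\le\varepsilon\}$, so that $d_h^2(p,p_\Delta)>\varepsilon$ whenever $|\Delta|>\omega_p(\varepsilon)$. *)

theory Defs
  imports "HOL-Probability.Probability"
begin

text \<open>Log-concave function on the real line: nonnegative, and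
  f(t x + (1-t) y) \<ge> f(x)^t f(y)^(1-t) for t in [0,1]; equivalently f = exp(-V)
  with V convex (V allowed to take the value +infinity).\<close>
definition log_concave :: "(real \<Rightarrow> real) \<Rightarrow> bool" where
  "log_concave f \<longleftrightarrow> (\<forall>x. 0 \<le> f x) \<and>
     (\<forall>x y t. 0 \<le> t \<and> t \<le> 1 \<longrightarrow> f x powr t * f y powr (1 - t) \<le> f (t * x + (1 - t) * y))"

definition sym_lc_density :: "(real \<Rightarrow> real) \<Rightarrow> bool" where
  "sym_lc_density f \<longleftrightarrow> log_concave f \<and> (\<forall>x. f (- x) = f x) \<and>
     integrable lborel f \<and> (\<integral>x. f x \<partial>lborel) = 1"

definition mixture :: "nat \<Rightarrow> (nat \<Rightarrow> real) \<Rightarrow> (nat \<Rightarrow> real \<Rightarrow> real) \<Rightarrow> real \<Rightarrow> real" where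
  "mixture k w q = (\<lambda>x. \<Sum>i<k. w i * q i x)"

definition hellinger_sq :: "(real \<Rightarrow> real) \<Rightarrow> (real \<Rightarrow> real) \<Rightarrow> real" where
  "hellinger_sq f g = 1/2 * (\<integral>x. (sqrt (f x) - sqrt (g x))^2 \<partial>lborel)"

definition hellinger_modulus :: "(real \<Rightarrow> real) \<Rightarrow> real \<Rightarrow> ereal" where
  "hellinger_modulus p \<epsilon> =
     Sup ((\<lambda>\<Delta>. ereal \<bar>\<Delta>\<bar>) ` {\<Delta>. hellinger_sq p (\<lambda>x. p (x - \<Delta>)) \<le> \<epsilon>})"

definition sample_space :: "(real \<Rightarrow> real) \<Rightarrow> real \<Rightarrow> nat \<Rightarrow> (nat \<Rightarrow> real) measure" where
  "sample_space p \<mu> n = PiM {..<n} (\<lambda>_. density lborel (\<lambda>x. ennreal (p (x - \<mu>))))"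

definition count_in :: "(nat \<Rightarrow> real) \<Rightarrow> nat \<Rightarrow> real \<Rightarrow> real \<Rightarrow> nat" where
  "count_in X n l r = card {i\<in>{..<n}. l \<le> X i \<and> X i \<le> r}"

definition passes_test :: "(nat \<Rightarrow> real) \<Rightarrow> nat \<Rightarrow> real \<Rightarrow> real \<Rightarrow> real \<Rightarrow> real \<Rightarrow> bool" where
  "passes_test X n \<mu>h a b \<gamma> \<longleftrightarrow>
     \<bar>sqrt (real (count_in X n (\<mu>h - b) (\<mu>h - a))) - sqrt (real (count_in X n (\<mu>h + a) (\<mu>h + b)))\<bar> \<le> \<gamma>"

definition valid_output :: "(nat \<Rightarrow> real) \<Rightarrow> nat \<Rightarrow> real \<Rightarrow> real \<Rightarrow> bool" where
  "valid_output X n \<gamma> \<mu>h \<longleftrightarrow> (\<forall>a b. 0 \<le> a \<and> a < b \<longrightarrow> passes_test X n \<mu>h a b \<gamma>)"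

end

theory Submission
  imports Defs
begin

text \<open>
  Reflecting a mixture \<open>p\<close> about \<open>s / 2\<close> gives its shift by \<open>s\<close>, so the test at an output
  \<open>m\<close> compares the masses of \<open>p\<close> and of its shift by \<open>s = 2 \<bar>\<mu> - m\<bar>\<close> on an interval.
  It remains to find, for any shift with large Hellinger distance, one interval that witnesses a
  \<open>1 / (k log n)\<close> fraction of it.
  On the half line where \<open>g = p\<close> dominates \<open>f = p (\<cdot> + s)\<close>, the Hellinger integral is at most
  \<open>\<Sum>\<^sub>i \<integral> d\<^sub>i (g - f) / g\<close>, where \<open>d\<^sub>i\<close> is the part of \<open>g - f\<close> due to component \<open>q\<^sub>i\<close>.
  By log-concavity \<open>d\<^sub>i / q\<^sub>i\<close> is increasing, while \<open>q\<^sub>i\<close> and \<open>g\<close> are decreasing, so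
  \<open>d\<^sub>i / (g q\<^sub>i\<^sup>2)\<close> is increasing. Up to a negligible part, \<open>O(log n)\<close> of its logarithmic level sets
  matter; they are intervals, and on each of them \<open>d\<^sub>i / g\<close> varies by a factor of at most \<open>e\<close>,
  which bounds the integral over the interval \<open>I\<close> by \<open>e (\<integral>\<^sub>I (g - f))\<^sup>2 / \<integral>\<^sub>I g\<close>.
  The counts are controlled uniformly over intervals by Chernoff bounds in square-root form on a
  grid of quantiles.
\<close>

section \<open>Symmetric log-concave densities\<close>

lemma sym_lc_nonneg: "sym_lc_density q \<Longrightarrow> 0 \<le> q x"
  by (simp add: sym_lc_density_def log_concave_def)

lemma sym_lc_measurable [measurable_dest]:
  "sym_lc_density q \<Longrightarrow> q \<in> borel_measurable borel"
  using borel_measurable_integrable[of lborel q] by (simp add: sym_lc_density_def)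

text \<open>Each point of \<open>[0, y]\<close> is a convex combination of \<open>y\<close> and
  \<open>- y\<close>. By symmetry \<open>q\<close> has the same value at both, and log-concavity
  makes that value a lower bound in between.\<close>

lemma sym_lc_antimono:
  assumes q: "sym_lc_density q" and xy: "0 \<le> x" "x \<le> y"
  shows "q y \<le> q x"
proof (cases "y = 0")
  case False
  define t where "t = (1 + x / y) / 2"
  have y: "0 < y" using False xy by simp
  have t: "0 \<le> t" "t \<le> 1" using xy y by (auto simp: t_def field_simps)
  have "q y powr t * q (- y) powr (1 - t) \<le> q (t * y + (1 - t) * (- y))"
    using q t unfolding sym_lc_density_def log_concave_def by blast
  moreover have "t * y + (1 - t) * (- y) = x" using y by (simp add: t_def field_simps)
  moreover have "q y powr t * q (- y) powr (1 - t) = q y"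
    using q sym_lc_nonneg[OF q, of y] by (simp add: sym_lc_density_def powr_add[symmetric])
  ultimately show ?thesis by simp
qed (use xy in auto)

text \<open>This is log-concavity at the midpoint of \<open>0\<close> and \<open>y\<close>. It
  controls the tail: where \<open>q y\<close> is below \<open>q 0 / N\<^sup>2\<close>, it is below
  \<open>q (y / 2) / N\<close>, whose integral is \<open>2 / N\<close>.\<close>

lemma sym_lc_half:
  assumes q: "sym_lc_density q"
  shows "q 0 * q y \<le> (q (y / 2))\<^sup>2"
proof -
  have "0 \<le> t \<and> t \<le> 1 \<Longrightarrow> q y powr t * q 0 powr (1 - t) \<le> q (t * y + (1 - t) * 0)" for t
    using q unfolding sym_lc_density_def log_concave_def by blast
  from this[of "1/2"]
  have "q y powr (1/2) * q 0 powr (1 - 1/2) \<le> q (1/2 * y + (1 - 1/2) * 0)"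
    by simp
  then have "sqrt (q y) * sqrt (q 0) \<le> q (y / 2)"
    using sym_lc_nonneg[OF q] by (simp add: powr_half_sqrt)
  then have "(sqrt (q y) * sqrt (q 0))\<^sup>2 \<le> (q (y / 2))\<^sup>2"
    by (intro power_mono) (use sym_lc_nonneg[OF q] in auto)
  then show ?thesis using sym_lc_nonneg[OF q] by (simp add: power_mult_distrib mult.commute)
qed

text \<open>Monotone likelihood ratio: \<open>q (x + D) / q x\<close> decreases in \<open>x\<close>,
  stated in product form because \<open>q\<close> may vanish. The inner points \<open>y\<close> and
  \<open>x + D\<close> are convex combinations of the outer points \<open>x\<close> and
  \<open>y + D\<close> with swapped weights, so multiplying the two log-concavity inequalities
  recombines the powers.\<close>

lemma sym_lc_ratio:
  assumes q: "sym_lc_density q" and xy: "x \<le> y" and D: "0 \<le> D"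
  shows "q x * q (y + D) \<le> q (x + D) * q y"
proof (cases "y + D = x")
  case True
  then have "x = y" "D = 0" using xy D by auto
  then show ?thesis by simp
next
  case False
  then have pos: "0 < y + D - x" using xy D by simp
  define t where "t = (y - x) / (y + D - x)"
  have t: "0 \<le> t" "t \<le> 1" using xy D pos by (auto simp: t_def field_simps)
  have lc: "q a powr s * q b powr (1 - s) \<le> q (s * a + (1 - s) * b)" if "0 \<le> s" "s \<le> 1" for a b s
    using q that unfolding sym_lc_density_def log_concave_def by blast
  have ty: "t * (y + D) + (1 - t) * x = y"
  proof -
    have "t * (y + D - x) = y - x" using pos by (simp add: t_def)
    then show ?thesis by (simp add: algebra_simps)
  qed
  have 1: "q (y + D) powr t * q x powr (1 - t) \<le> q y"
    using lc[OF t, of "y + D" x] unfolding ty .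
  have "t * x + (1 - t) * (y + D) = x + D"
    using ty by (simp add: algebra_simps)
  then have 2: "q x powr t * q (y + D) powr (1 - t) \<le> q (x + D)"
    using lc[OF t, of x "y + D"] by simp
  have "q x * q (y + D) = (q x powr t * q (y + D) powr (1 - t)) * (q (y + D) powr t * q x powr (1 - t))"
  proof -
    have e: "a powr t * a powr (1 - t) = a" if "0 \<le> a" for a :: real
      using that by (simp add: powr_add[symmetric])
    have "q x * q (y + D) = (q x powr t * q x powr (1 - t)) * (q (y + D) powr t * q (y + D) powr (1 - t))"
      by (simp add: e sym_lc_nonneg[OF q])
    then show ?thesis by (simp add: ac_simps)
  qed
  also have "\<dots> \<le> q (x + D) * q y"
    by (intro mult_mono 1 2) (auto simp: sym_lc_nonneg[OF q])
  finally show ?thesis .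
qed

section \<open>Interval tests and Hellinger distance\<close>

text \<open>If \<open>d / g\<close> is constant on \<open>I\<close> up to the factor
  \<open>c\<close>, it is at most \<open>c\<close> times its \<open>g\<close>-weighted mean, hence
  at most \<open>c * V / G\<close> with \<open>V\<close> and \<open>G\<close> the integrals of
  \<open>v\<close> and \<open>g\<close>. Integrating this against \<open>v\<close> gives
  \<open>c * V\<^sup>2 / G\<close>, which is what the test controls.\<close>

lemma cell_bound:
  fixes I :: "real set" and d g v :: "real \<Rightarrow> real"
  assumes [measurable]: "I \<in> sets borel" "d \<in> borel_measurable borel"
      "g \<in> borel_measurable borel" "v \<in> borel_measurable borel"
    and g: "set_integrable lborel I g"
    and dvg: "\<And>y. y \<in> I \<Longrightarrow> 0 < g y \<and> 0 \<le> d y \<and> d y \<le> v y \<and> v y \<le> g y"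
    and cmp: "\<And>x y. x \<in> I \<Longrightarrow> y \<in> I \<Longrightarrow> d x / g x \<le> c * (d y / g y)"
    and test: "(LINT y:I|lborel. v y)\<^sup>2 \<le> \<eta> * (LINT y:I|lborel. g y)"
    and "0 \<le> c" "0 \<le> \<eta>"
  shows "(\<integral>\<^sup>+y\<in>I. ennreal (d y * v y / g y) \<partial>lborel) \<le> ennreal (c * \<eta>)"
proof -
  let ?G = "LINT y:I|lborel. g y" and ?V = "LINT y:I|lborel. v y"
  have sub: "set_integrable lborel I f"
    if [measurable]: "f \<in> borel_measurable borel" and f: "\<And>y. y \<in> I \<Longrightarrow> 0 \<le> f y \<and> f y \<le> g y"
    for f :: "real \<Rightarrow> real"
  proof (rule set_integrable_bound[OF g])
    show "set_borel_measurable lborel I f" unfolding set_borel_measurable_def by measurable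
    show "AE y in lborel. y \<in> I \<longrightarrow> norm (f y) \<le> norm (g y)"
      using f by (intro AE_I2) fastforce
  qed
  have v: "set_integrable lborel I v"
    by (rule sub) (use dvg in force)+
  have d: "set_integrable lborel I d"
    by (rule sub) (use dvg in force)+
  have VG: "?V \<le> ?G" and dV: "(LINT y:I|lborel. d y) \<le> ?V"
    using dvg by (auto intro!: set_integral_mono g v d)
  have V0: "0 \<le> ?V"
    unfolding set_lebesgue_integral_def using dvg
    by (intro integral_nonneg_AE AE_I2) (fastforce simp: indicator_def)
  have nnv: "(\<integral>\<^sup>+y\<in>I. ennreal (a * v y) \<partial>lborel) = ennreal (a * ?V)" if "0 \<le> a" for a
  proof -
    have "(\<integral>\<^sup>+y\<in>I. ennreal (a * v y) \<partial>lborel) = (\<integral>\<^sup>+y. ennreal (indicator I y *\<^sub>R (a * v y)) \<partial>lborel)"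
      by (intro nn_integral_cong) (auto simp: indicator_def)
    also have "\<dots> = ennreal (LINT y:I|lborel. a * v y)"
      unfolding set_lebesgue_integral_def
    proof (rule nn_integral_eq_integral)
      show "integrable lborel (\<lambda>y. indicator I y *\<^sub>R (a * v y))"
        using set_integrable_mult_right[of a lborel I v] v by (simp add: set_integrable_def)
      show "AE y in lborel. 0 \<le> indicator I y *\<^sub>R (a * v y)"
        using dvg that by (intro AE_I2) (fastforce simp: indicator_def)
    qed
    finally show ?thesis by simp
  qed
  show ?thesis
  \<comment> \<open>A null cell is treated apart, since the mean of \<open>d / g\<close> over it is
    undefined. There \<open>V = 0\<close>, and the integrand is at most \<open>v\<close>.\<close>
  proof (cases "?G = 0")
    case True
    then have "?V = 0" using VG V0 by simp
    have "(\<integral>\<^sup>+y\<in>I. ennreal (d y * v y / g y) \<partial>lborel) \<le> (\<integral>\<^sup>+y\<in>I. ennreal (1 * v y) \<partial>lborel)"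
    proof (rule nn_integral_mono)
      fix y show "ennreal (d y * v y / g y) * indicator I y \<le> ennreal (1 * v y) * indicator I y"
      proof (cases "y \<in> I")
        case True
        from dvg[OF True] have "d y * v y / g y \<le> 1 * v y"
          by (simp add: divide_le_eq mult_mono mult.commute)
        then show ?thesis by (auto intro!: mult_right_mono ennreal_leI)
      qed simp
    qed
    also have "\<dots> = 0" using nnv[of 1] \<open>?V = 0\<close> by simp
    finally show ?thesis by simp
  next
    case False
    then have G0: "0 < ?G" using VG V0 by simp
    have r: "d y / g y \<le> c * ?V / ?G" if y: "y \<in> I" for y
    proof -
      have "d y / g y * ?G = (LINT x:I|lborel. d y / g y * g x)" by simp
      also have "\<dots> \<le> (LINT x:I|lborel. c * d x)"
      proof (rule set_integral_mono)
        fix x assume x: "x \<in> I"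
        from dvg[OF x] have "c * d x = c * (d x / g x) * g x" by simp
        moreover have "d y / g y * g x \<le> c * (d x / g x) * g x"
          using cmp[OF y x] dvg[OF x] by (intro mult_right_mono) auto
        ultimately show "d y / g y * g x \<le> c * d x" by linarith
      qed (use g d in auto)
      also have "\<dots> = c * (LINT x:I|lborel. d x)" by simp
      also have "\<dots> \<le> c * ?V" using dV \<open>0 \<le> c\<close> by (rule mult_left_mono)
      finally show ?thesis using G0 by (simp add: field_simps)
    qed
    have "(\<integral>\<^sup>+y\<in>I. ennreal (d y * v y / g y) \<partial>lborel) \<le> (\<integral>\<^sup>+y\<in>I. ennreal (c * ?V / ?G * v y) \<partial>lborel)"
    proof (rule nn_integral_mono)
      fix y show "ennreal (d y * v y / g y) * indicator I y \<le> ennreal (c * ?V / ?G * v y) * indicator I y"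
      proof (cases "y \<in> I")
        case True
        have "d y / g y * v y \<le> c * ?V / ?G * v y"
          using r[OF True] dvg[OF True] by (intro mult_right_mono) auto
        then show ?thesis by (auto intro!: mult_right_mono ennreal_leI)
      qed simp
    qed
    also have "\<dots> = ennreal (c * ?V / ?G * ?V)"
      using V0 G0 \<open>0 \<le> c\<close> by (intro nnv) simp
    also have "\<dots> \<le> ennreal (c * \<eta>)"
    proof (rule ennreal_leI)
      have "?V\<^sup>2 / ?G \<le> \<eta>" using test G0 by (simp add: divide_le_eq)
      then have "c * (?V\<^sup>2 / ?G) \<le> c * \<eta>" using \<open>0 \<le> c\<close> by (rule mult_left_mono)
      then show "c * ?V / ?G * ?V \<le> c * \<eta>" by (simp add: power2_eq_square)
    qed
    finally show ?thesis .
  qed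
qed

text \<open>A bounded interval differs from the closed one only in its endpoints, a null set. Level
  sets of a monotone function may be open or half-open, whereas the tests concern closed
  intervals.\<close>

lemma interval_integral_closed:
  fixes I :: "real set" and h :: "real \<Rightarrow> real"
  assumes "is_interval I" "bounded I" "I \<noteq> {}"
    and [measurable]: "I \<in> sets borel" "h \<in> borel_measurable borel"
  shows "(LINT y:I|lborel. h y) = (LINT y:{Inf I..Sup I}|lborel. h y)"
proof -
  have bd: "bdd_above I" "bdd_below I" using assms(2) by (auto intro: bounded_imp_bdd_above bounded_imp_bdd_below)
  have 1: "I \<subseteq> {Inf I..Sup I}" using bd by (auto intro: cInf_lower cSup_upper)
  have 2: "y \<in> I" if y: "Inf I < y" "y < Sup I" for y
  proof -
    obtain a where "a \<in> I" "a < y" using cInf_lessD[OF assms(3) y(1)] by blast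
    moreover obtain b where "b \<in> I" "y < b" using less_cSupD[OF assms(3) y(2)] by blast
    ultimately show ?thesis using mem_is_interval_1_I[OF assms(1), of a b y] by simp
  qed
  have "AE y in lborel. y \<noteq> Inf I" "AE y in lborel. y \<noteq> Sup I" by (rule AE_lborel_singleton)+
  then have "AE y in lborel. y \<in> I \<longleftrightarrow> y \<in> {Inf I..Sup I}"
  proof eventually_elim
    case (elim y)
    show ?case using elim 1 2[of y] by force
  qed
  then show ?thesis
    by (intro set_integral_cong_set[symmetric])
       (auto simp: set_borel_measurable_def)
qed

text \<open>Extends the test inequality from closed intervals \<open>[a, b]\<close> with
  \<open>a < b\<close> to every bounded interval of the half line; on an empty or degenerate
  interval both sides vanish.\<close>

lemma cell_test:
  fixes I :: "real set" and g v :: "real \<Rightarrow> real"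
  assumes I: "is_interval I" "bounded I" "I \<subseteq> {0..}"
    and [measurable]: "I \<in> sets borel" "g \<in> borel_measurable borel" "v \<in> borel_measurable borel"
    and test: "\<And>a b. 0 \<le> a \<Longrightarrow> a < b \<Longrightarrow>
       (LINT y:{a..b}|lborel. v y)\<^sup>2 \<le> \<eta> * (LINT y:{a..b}|lborel. g y)"
  shows "(LINT y:I|lborel. v y)\<^sup>2 \<le> \<eta> * (LINT y:I|lborel. g y)"
proof (cases "I = {}")
  case False
  have "0 \<le> Inf I" using False I(3) by (intro cInf_greatest) auto
  have "Inf I \<le> Sup I"
    using False I(2) by (intro cInf_le_cSup) (auto intro: bounded_imp_bdd_above bounded_imp_bdd_below)
  then consider "Inf I = Sup I" | "Inf I < Sup I" by linarith
  then show ?thesis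
  proof cases
    case 1
    have "(LINT y:{a..a}|lborel. h y) = 0" for a and h :: "real \<Rightarrow> real"
      unfolding set_lebesgue_integral_def
      by (rule integral_eq_zero_AE, use AE_lborel_singleton[of a] in eventually_elim) auto
    then show ?thesis
      using 1 by (simp add: interval_integral_closed[OF I(1,2) False])
  next
    case 2
    then show ?thesis
      using test[OF \<open>0 \<le> Inf I\<close> 2] by (simp add: interval_integral_closed[OF I(1,2) False])
  qed
qed (simp add: set_lebesgue_integral_def)

section \<open>Contribution of a single component to the Hellinger integral\<close>

lemma sym_lc_level_bound:
  assumes q: "sym_lc_density q" and "0 \<le> y"
  shows "y * q y \<le> 1"
proof -
  have i: "integrable lborel q" "(\<integral>x. q x \<partial>lborel) = 1" using q by (auto simp: sym_lc_density_def)
  have "y * q y = (LINT x|lborel. indicator {0..y} x * q y)" using \<open>0 \<le> y\<close> by simp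
  also have "\<dots> \<le> (LINT x|lborel. q x)"
  proof (rule integral_mono)
    show "integrable lborel (\<lambda>x. indicator {0..y} x * q y)" 
      by (intro integrable_mult_left integrable_real_indicator) (use assms in auto)
    show "indicator {0..y} x * q y \<le> q x" for x
      using sym_lc_antimono[OF q, of x y] sym_lc_nonneg[OF q] by (auto simp: indicator_def)
  qed (fact i)
  finally show ?thesis using i by simp
qed

text \<open>The half line is split into the points with \<open>d y / g y < 1 / N\<close>, which
  contribute at most \<open>1 / N\<close>, those with \<open>q y < q 0 / N\<^sup>2\<close>, which
  contribute at most \<open>2 / N\<close>, and the rest. The rest is covered by at most
  \<open>5 * ln N + 1\<close> cells, and \<open>cell_bound\<close> with \<open>c = exp 1\<close>
  applies to each of them.\<close>

lemma component_bound:
  fixes q g v d :: "real \<Rightarrow> real"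
  assumes q: "sym_lc_density q" and w: "0 \<le> w" "w \<le> 1" and N: "1 \<le> N" and D: "0 \<le> D" and \<eta>: "0 \<le> \<eta>"
    and [measurable]: "g \<in> borel_measurable borel" "v \<in> borel_measurable borel"
    and g: "integrable lborel g" "(\<integral>y. g y \<partial>lborel) \<le> 1" "\<And>y. 0 \<le> g y"
      "\<And>x y. 0 \<le> x \<Longrightarrow> x \<le> y \<Longrightarrow> g y \<le> g x"
    and d: "\<And>y. d y = w * (q y - q (y + D))"
    and dv: "\<And>y. 0 \<le> y \<Longrightarrow> d y \<le> v y \<and> v y \<le> g y"
    and test: "\<And>a b. 0 \<le> a \<Longrightarrow> a < b \<Longrightarrow>
       (LINT y:{a..b}|lborel. v y)\<^sup>2 \<le> \<eta> * (LINT y:{a..b}|lborel. g y)"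
  shows "(\<integral>\<^sup>+y\<in>{0..}. ennreal (d y * v y / g y) \<partial>lborel)
    \<le> ennreal (3 / N + (5 * ln N + 1) * (exp 1 * \<eta>))"
proof -
  note [measurable] = sym_lc_measurable[OF q]
  have [measurable]: "d \<in> borel_measurable borel"
    unfolding d[abs_def] by measurable
  have q0: "0 \<le> q y" for y by (rule sym_lc_nonneg[OF q])
  have d0: "0 \<le> d y" if "0 \<le> y" for y
    using sym_lc_antimono[OF q, of y "y + D"] that D w by (simp add: d)
  \<comment> \<open>Off \<open>S\<close> the integrand vanishes on the half line; on
    \<open>S\<close> all logarithms used below have positive arguments.\<close>
  define S where "S = {y. 0 \<le> y \<and> 0 < d y}"
  have S: "0 \<le> y" "0 < d y" "0 < w" "0 < q y" "0 < g y" "q y \<le> q 0" "0 < q 0" "q (y + D) < q y" if "y \<in> S" for y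
  proof -
    show y: "0 \<le> y" "0 < d y" using that by (auto simp: S_def)
    show w0: "0 < w" using y w d by (cases "w = 0") auto
    show qq: "q (y + D) < q y" using y w0 by (simp add: d zero_less_mult_iff)
    show qy: "0 < q y" using qq q0[of "y + D"] by linarith
    show "0 < g y" using y dv[of y] by linarith
    show "q y \<le> q 0" using sym_lc_antimono[OF q, of 0 y] y by simp
    then show "0 < q 0" using qy by linarith
  qed
  \<comment> \<open>On \<open>S\<close> this is the logarithm of \<open>d / (g * q\<^sup>2)\<close>
    up to a constant, chosen so that \<open>h\<close> ranges over \<open>[0, 5 * ln N]\<close> on
    the part that is not negligible.\<close>
  define h where "h y = ln N + 2 * ln (q 0) + ln (d y) - ln (g y) - 2 * ln (q y)" for y
  have [measurable]: "h \<in> borel_measurable borel" "S \<in> sets borel"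
    unfolding h_def S_def by measurable
  have mono: "ln (q y) \<le> ln (q x)" "ln (g y) \<le> ln (g x)"
      "ln (d x) - ln (q x) \<le> ln (d y) - ln (q y)" "h x \<le> h y"
    if x: "x \<in> S" and y: "y \<in> S" and xy: "x \<le> y" for x y
  proof -
    note Sx = S[OF x] and Sy = S[OF y]
    show 1: "ln (q y) \<le> ln (q x)"
      using sym_lc_antimono[OF q, of x y] Sx Sy xy by simp
    show 2: "ln (g y) \<le> ln (g x)" using g(4)[of x y] Sx Sy xy by simp
    have "w * (q x * q (y + D)) \<le> w * (q (x + D) * q y)"
      using sym_lc_ratio[OF q xy D] w by (intro mult_left_mono)
    then have "d x * q y \<le> d y * q x" by (simp add: d algebra_simps)
    then have "ln (d x * q y) \<le> ln (d y * q x)" using Sx Sy by simp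
    then show 3: "ln (d x) - ln (q x) \<le> ln (d y) - ln (q y)" using Sx Sy by (simp add: ln_mult)
    show "h x \<le> h y" unfolding h_def using 1 2 3 by linarith
  qed
  define cell where "cell j = {y \<in> S. q 0 / N\<^sup>2 \<le> q y \<and> \<lfloor>h y\<rfloor> = int j}" for j :: nat
  have [measurable]: "cell j \<in> sets borel" for j unfolding cell_def by measurable
  have cmp: "d x / g x \<le> exp 1 * (d y / g y)" if "x \<in> cell j" "y \<in> cell j" for x y j
  proof -
    have xy: "x \<in> S" "y \<in> S" "\<lfloor>h x\<rfloor> = \<lfloor>h y\<rfloor>" using that by (auto simp: cell_def)
    have "\<bar>h x - h y\<bar> \<le> 1" using xy(3) by linarith
    \<comment> \<open>The increment of \<open>h\<close> is the sum of three increments of the same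
      sign, those of \<open>ln d - ln q\<close>, \<open>- ln g\<close> and \<open>- ln q\<close>.
      The increment of \<open>ln d - ln g\<close> is the first plus the second minus the third, so
      it is bounded by that of \<open>h\<close> in absolute value. This is why \<open>q\<close>
      enters \<open>h\<close> squared.\<close>
    then have "ln (d x) - ln (g x) \<le> 1 + (ln (d y) - ln (g y))"
      using mono[OF xy(1,2)] mono[OF xy(2,1)] unfolding h_def by linarith
    then have "ln (d x / g x) \<le> ln (exp 1 * (d y / g y))"
      using S[OF xy(1)] S[OF xy(2)] by (simp add: ln_div ln_mult)
    then show ?thesis using S[OF xy(1)] S[OF xy(2)] by simp
  qed
  have cell_int: "is_interval (cell j)" for j
    unfolding is_interval_1
  proof (intro ballI allI impI, elim conjE)
    fix x z y assume x: "x \<in> cell j" and z: "z \<in> cell j" and xyz: "x \<le> y" "y \<le> z"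
    have xS: "x \<in> S" and zS: "z \<in> S" using x z by (auto simp: cell_def)
    have y0: "0 \<le> y" using S(1)[OF xS] xyz by simp
    have qyz: "q z \<le> q y" using sym_lc_antimono[OF q y0 xyz(2)] .
    have qy: "0 < q y" using qyz S(4)[OF zS] by simp
    \<comment> \<open>Positivity of \<open>d\<close> passes from \<open>x\<close> to
      \<open>y\<close>: if \<open>q\<close> did not drop from \<open>y\<close> to
      \<open>y + D\<close>, the ratio inequality would forbid a drop from \<open>x\<close> to
      \<open>x + D\<close>. So a cell has no gaps outside \<open>S\<close>.\<close>
    have "\<not> q y \<le> q (y + D)"
    proof
      assume "q y \<le> q (y + D)"
      then have "q x * q y \<le> q x * q (y + D)" using q0 by (intro mult_left_mono)
      also have "\<dots> \<le> q (x + D) * q y" by (rule sym_lc_ratio[OF q xyz(1) D])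
      finally show False using qy S(8)[OF xS] by simp
    qed
    then have yS: "y \<in> S" using y0 S(3)[OF xS] by (auto simp: S_def d)
    have "h x \<le> h y" "h y \<le> h z" using mono[OF xS yS] mono[OF yS zS] xyz by auto
    then have "\<lfloor>h y\<rfloor> = int j" using x z floor_mono[of "h x" "h y"] floor_mono[of "h y" "h z"] by (simp add: cell_def)
    then show "y \<in> cell j" using yS z qyz by (simp add: cell_def)
  qed
  have cell_bd: "bounded (cell j)" for j
  proof (rule boundedI)
    fix y assume "y \<in> cell j"
    then have y: "y \<in> S" "q 0 / N\<^sup>2 \<le> q y" by (auto simp: cell_def)
    \<comment> \<open>The lower cutoff on \<open>q\<close> is what bounds a cell, because
      \<open>y * q y\<close> cannot exceed the total mass.\<close>
    have "y * (q 0 / N\<^sup>2) \<le> y * q y" using y(2) S(1)[OF y(1)] by (rule mult_left_mono)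
    also have "\<dots> \<le> 1" by (rule sym_lc_level_bound[OF q S(1)[OF y(1)]])
    finally show "norm y \<le> N\<^sup>2 / q 0" using S(7)[OF y(1)] N S(1)[OF y(1)] by (simp add: field_simps)
  qed
  have cell_le: "(\<integral>\<^sup>+y\<in>cell j. ennreal (d y * v y / g y) \<partial>lborel) \<le> ennreal (exp 1 * \<eta>)" for j
  proof (rule cell_bound)
    show "set_integrable lborel (cell j) g"
      using g(1) unfolding set_integrable_def by (intro integrable_mult_indicator) auto
    show "(LINT y:cell j|lborel. v y)\<^sup>2 \<le> \<eta> * (LINT y:cell j|lborel. g y)"
      by (rule cell_test[OF cell_int cell_bd _ _ _ _ test]) (use S in \<open>auto simp: cell_def[of j]\<close>)
    show "0 < g y \<and> 0 \<le> d y \<and> d y \<le> v y \<and> v y \<le> g y" if "y \<in> cell j" for y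
      using that S[of y] dv[of y] by (auto simp: cell_def)
  qed (use cmp \<eta> in auto)
  define m where "m = nat \<lfloor>5 * ln N\<rfloor>"
  have lnN: "0 \<le> ln N" using N by simp
  have pw: "ennreal (d y * v y / g y) * indicator {0..} y \<le>
     ennreal (g y / N) + ennreal (q (y / 2) / N) + (\<Sum>j\<le>m. ennreal (d y * v y / g y) * indicator (cell j) y)"
    (is "?L \<le> ?A + ?B + ?C") for y
  proof (cases "y \<in> S")
    case False
    then have "y < 0 \<or> d y = 0" using d0[of y] by (fastforce simp: S_def)
    then have L: "?L = 0" by auto
    show ?thesis unfolding L by (rule zero_le)
  next
    case True
    note Sy = S[OF True]
    have vg: "0 < v y" "v y \<le> g y" "d y \<le> v y" using dv[of y] Sy by auto
    consider "d y / g y < 1 / N" | "q y < q 0 / N\<^sup>2" | "1 / N \<le> d y / g y" "q 0 / N\<^sup>2 \<le> q y" by linarith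
    then show ?thesis
    proof cases
      case 1
      have "d y / g y * v y \<le> 1 / N * g y"
        using 1 vg Sy N by (intro mult_mono) auto
      then have "?L \<le> ?A" using Sy by (auto intro: ennreal_leI)
      then show ?thesis by (auto intro: order_trans add_increasing2)
    next
      case 2
      have "(q y)\<^sup>2 \<le> q y * (q 0 / N\<^sup>2)"
        using 2 Sy mult_left_mono[of "q y" "q 0 / N\<^sup>2" "q y"] by (simp add: power2_eq_square[of "q y"])
      also have "\<dots> \<le> (q (y / 2) / N)\<^sup>2"
        using sym_lc_half[OF q, of y] N by (simp add: power_divide divide_right_mono mult.commute)
      finally have qh: "q y \<le> q (y / 2) / N" 
        by (rule power2_le_imp_le) (use q0[of "y / 2"] N in simp)
      have "d y * (v y / g y) \<le> d y * 1" using vg Sy by (intro mult_left_mono) auto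
      also have "d y * 1 \<le> q y"
        using mult_mono[of w 1 "q y - q (y + D)" "q y"] w q0[of "y + D"] Sy(4,8) by (simp add: d)
      finally have "?L \<le> ?B" using Sy qh by (auto intro: ennreal_leI)
      then show ?thesis by (metis add.commute add_increasing2 zero_le)
    next
      case 3
      have "ln (1 / N) \<le> ln (d y / g y)" using 3 Sy N by (subst ln_le_cancel_iff) auto
      then have a: "- ln N \<le> ln (d y) - ln (g y)" using Sy N by (simp add: ln_div)
      have "ln (q 0 / N\<^sup>2) \<le> ln (q y)" using 3 Sy N by (subst ln_le_cancel_iff) auto
      then have b: "ln (q 0) - 2 * ln N \<le> ln (q y)" using Sy N by (simp add: ln_div ln_realpow)
      have c: "ln (q y) \<le> ln (q 0)" "ln (d y) \<le> ln (g y)" using Sy vg by auto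
      \<comment> \<open>The cutoff on \<open>d / g\<close> gives the lower bound. In the upper bound
        one \<open>ln N\<close> is the constant in \<open>h\<close> and four come from the cutoff
        \<open>q 0 / N\<^sup>2\<close>, as \<open>q\<close> is squared.\<close>
      have h: "0 \<le> h y" "h y \<le> 5 * ln N" unfolding h_def using a b c by linarith+
      define j where "j = nat \<lfloor>h y\<rfloor>"
      have "y \<in> cell j" using True 3 h by (simp add: cell_def j_def)
      moreover have "j \<le> m" unfolding j_def m_def using h by (intro nat_mono floor_mono)
      ultimately have "?L \<le> ?C"
        using Sy by (intro order_trans[OF _ member_le_sum[of j]]) auto
      then show ?thesis by (metis add.commute add_increasing2 zero_le)
    qed
  qed
  have A: "(\<integral>\<^sup>+y. ennreal (g y / N) \<partial>lborel) \<le> ennreal (1 / N)"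
  proof -
    have "(\<integral>\<^sup>+y. ennreal (g y / N) \<partial>lborel) = ennreal (\<integral>y. g y / N \<partial>lborel)"
      using g N by (intro nn_integral_eq_integral) auto
    then show ?thesis using g N by (auto intro!: ennreal_leI divide_right_mono)
  qed
  have B: "(\<integral>\<^sup>+y. ennreal (q (y / 2) / N) \<partial>lborel) = ennreal (2 / N)"
  proof -
    have "(\<integral>\<^sup>+y. ennreal (q (y / 2) / N) \<partial>lborel) = 2 * (\<integral>\<^sup>+y. ennreal (q y / N) \<partial>lborel)"
      by (subst nn_integral_real_affine[where c = 2 and t = 0]) auto
    also have "(\<integral>\<^sup>+y. ennreal (q y / N) \<partial>lborel) = ennreal (\<integral>y. q y / N \<partial>lborel)"
      using q N q0 by (intro nn_integral_eq_integral) (auto simp: sym_lc_density_def)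
    also have "\<dots> = ennreal (1 / N)" using q by (simp add: sym_lc_density_def)
    finally show ?thesis using N by (simp add: ennreal_mult'[symmetric] flip: ennreal_numeral)
  qed
  have "(\<integral>\<^sup>+y\<in>{0..}. ennreal (d y * v y / g y) \<partial>lborel) \<le>
    (\<integral>\<^sup>+y. ennreal (g y / N) + ennreal (q (y / 2) / N) + (\<Sum>j\<le>m. ennreal (d y * v y / g y) * indicator (cell j) y) \<partial>lborel)"
    by (intro nn_integral_mono pw)
  also have "\<dots> = (\<integral>\<^sup>+y. ennreal (g y / N) \<partial>lborel) + (\<integral>\<^sup>+y. ennreal (q (y / 2) / N) \<partial>lborel)
     + (\<Sum>j\<le>m. \<integral>\<^sup>+y. ennreal (d y * v y / g y) * indicator (cell j) y \<partial>lborel)"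
  proof -
    have "(\<integral>\<^sup>+y. (\<Sum>j\<le>m. ennreal (d y * v y / g y) * indicator (cell j) y) \<partial>lborel)
      = (\<Sum>j\<le>m. \<integral>\<^sup>+y. ennreal (d y * v y / g y) * indicator (cell j) y \<partial>lborel)"
      by (intro nn_integral_sum) measurable
    moreover have "(\<lambda>y. \<Sum>j\<le>m. ennreal (d y * v y / g y) * indicator (cell j) y) \<in> borel_measurable lborel"
      by measurable
    ultimately show ?thesis
      by (simp add: nn_integral_add del: sum_mult_indicator sum.cong)
  qed
  also have "\<dots> \<le> ennreal (1 / N) + ennreal (2 / N) + (\<Sum>j\<le>m. ennreal (exp 1 * \<eta>))"
    by (intro add_mono sum_mono A eq_refl[OF B] cell_le)
  also have "\<dots> = ennreal (1 / N + 2 / N + real (m + 1) * (exp 1 * \<eta>))"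
    using N \<eta> by (simp add: ennreal_plus[symmetric] ennreal_of_nat_eq_real_of_nat ennreal_mult'[symmetric] del: ennreal_plus of_nat_add)
  also have "\<dots> \<le> ennreal (3 / N + (5 * ln N + 1) * (exp 1 * \<eta>))"
  proof (rule ennreal_leI)
    have "real m \<le> 5 * ln N" unfolding m_def using lnN by linarith
    then have "real (m + 1) * (exp 1 * \<eta>) \<le> (5 * ln N + 1) * (exp 1 * \<eta>)"
      using \<eta> by (intro mult_right_mono) auto
    then show "1 / N + 2 / N + real (m + 1) * (exp 1 * \<eta>) \<le> 3 / N + (5 * ln N + 1) * (exp 1 * \<eta>)"
      by (simp add: add_divide_distrib[symmetric])
  qed
  finally show ?thesis .
qed

text \<open>Reflection about \<open>D / 2\<close> exchanges \<open>p\<close> and its shift. The line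
  is cut at \<open>0\<close>, \<open>D / 2\<close> and \<open>D\<close>, and on each of the four
  pieces the integrand is at most a translate or reflection of the half-line integrand. The four
  copies and the factor \<open>1 / 2\<close> of the Hellinger distance give
  \<open>2 * c\<close>.\<close>

lemma hellinger_sq_le_half_line:
  fixes p :: "real \<Rightarrow> real"
  assumes [measurable]: "p \<in> borel_measurable borel"
    and even: "\<And>x. p (- x) = p x" and nonneg: "\<And>x. 0 \<le> p x"
    and anti: "\<And>x y. 0 \<le> x \<Longrightarrow> x \<le> y \<Longrightarrow> p y \<le> p x" and "0 \<le> D" and "0 \<le> c"
    and bound: "(\<integral>\<^sup>+y\<in>{0..}. ennreal ((sqrt (p y) - sqrt (p (y + D)))\<^sup>2) \<partial>lborel) \<le> ennreal c"
  shows "hellinger_sq p (\<lambda>x. p (x - D)) \<le> 2 * c"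
proof -
  define \<psi> where "\<psi> y = ennreal ((sqrt (p y) - sqrt (p (y + D)))\<^sup>2) * indicator {0..} y" for y
  have [measurable]: "\<psi> \<in> borel_measurable borel" unfolding \<psi>_def by measurable
  have sq: "(sqrt a - sqrt b)\<^sup>2 \<le> (sqrt a' - sqrt b')\<^sup>2" if "b' \<le> b" "b \<le> a" "a \<le> a'" for a b a' b' :: real
    using that by (intro power_mono) (auto intro!: diff_mono real_sqrt_le_mono)
  have pw: "ennreal ((sqrt (p x) - sqrt (p (x - D)))\<^sup>2) \<le> \<psi> (- D + 1 * x) + \<psi> (0 + (-1) * x) + \<psi> x + \<psi> (D + (-1) * x)"
    for x
  proof -
    consider "D \<le> x" | "x \<le> 0" | "0 \<le> x" "x \<le> D / 2" | "D / 2 \<le> x" "x \<le> D" by linarith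
    then show ?thesis
    proof cases
      case 1
      then have "ennreal ((sqrt (p x) - sqrt (p (x - D)))\<^sup>2) \<le> \<psi> (- D + 1 * x)"
        by (simp add: \<psi>_def power2_commute)
      then show ?thesis by (rule order_trans) (simp add: add.assoc)
    next
      case 2
      have "p (x - D) = p (D - x)" using even[of "D - x"] by simp
      with 2 have "ennreal ((sqrt (p x) - sqrt (p (x - D)))\<^sup>2) \<le> \<psi> (0 + (-1) * x)"
        by (simp add: \<psi>_def even)
      then show ?thesis by (rule order_trans) (simp add: ac_simps add_increasing)
    next
      case 3
      have "p (x - D) = p (D - x)" using even[of "D - x"] by simp
      \<comment> \<open>Between the two centers the smaller value is lowered further:
        \<open>x \<le> D - x \<le> x + D\<close>, so the gap only grows. The last case is the mirror
        image.\<close>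
      then have "(sqrt (p x) - sqrt (p (x - D)))\<^sup>2 \<le> (sqrt (p x) - sqrt (p (x + D)))\<^sup>2"
        using 3 \<open>0 \<le> D\<close> by (intro sq) (auto intro!: anti)
      with 3 have "ennreal ((sqrt (p x) - sqrt (p (x - D)))\<^sup>2) \<le> \<psi> x"
        by (simp add: \<psi>_def ennreal_leI)
      then show ?thesis by (rule order_trans) (simp add: ac_simps add_increasing)
    next
      case 4
      have "p (x - D) = p (D - x)" using even[of "D - x"] by simp
      then have "(sqrt (p x) - sqrt (p (x - D)))\<^sup>2 \<le> (sqrt (p (D - x)) - sqrt (p (D - x + D)))\<^sup>2"
        using 4 \<open>0 \<le> D\<close> by (subst power2_commute) (auto intro!: sq anti)
      with 4 have "ennreal ((sqrt (p x) - sqrt (p (x - D)))\<^sup>2) \<le> \<psi> (D + (-1) * x)"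
        by (simp add: \<psi>_def ennreal_leI)
      then show ?thesis by (rule order_trans) (simp add: ac_simps add_increasing)
    qed
  qed
  have "(\<integral>\<^sup>+x. ennreal ((sqrt (p x) - sqrt (p (x - D)))\<^sup>2) \<partial>lborel) \<le>
    (\<integral>\<^sup>+x. \<psi> (- D + 1 * x) + \<psi> (0 + (-1) * x) + \<psi> x + \<psi> (D + (-1) * x) \<partial>lborel)"
    by (intro nn_integral_mono pw)
  also have "\<dots> = (\<integral>\<^sup>+x. \<psi> (- D + 1 * x) \<partial>lborel) + (\<integral>\<^sup>+x. \<psi> (0 + (-1) * x) \<partial>lborel)
      + (\<integral>\<^sup>+x. \<psi> x \<partial>lborel) + (\<integral>\<^sup>+x. \<psi> (D + (-1) * x) \<partial>lborel)"
    by (simp add: nn_integral_add)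
  also have "\<dots> = 4 * (\<integral>\<^sup>+x. \<psi> x \<partial>lborel)"
  proof -
    have aff: "(\<integral>\<^sup>+x. \<psi> (t + s * x) \<partial>lborel) = (\<integral>\<^sup>+x. \<psi> x \<partial>lborel)" if "s = 1 \<or> s = - 1" for t s
      using that nn_integral_real_affine[of \<psi> s t] by auto
    have "(\<integral>\<^sup>+x. \<psi> (- D + 1 * x) \<partial>lborel) = (\<integral>\<^sup>+x. \<psi> x \<partial>lborel)"
      "(\<integral>\<^sup>+x. \<psi> (0 + (-1) * x) \<partial>lborel) = (\<integral>\<^sup>+x. \<psi> x \<partial>lborel)"
      "(\<integral>\<^sup>+x. \<psi> (D + (-1) * x) \<partial>lborel) = (\<integral>\<^sup>+x. \<psi> x \<partial>lborel)"
      by (rule aff, simp)+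
    moreover have "a + a + a + a = 4 * a" for a :: ennreal
    proof -
      have "a + a + a + a = (1 + 1 + 1 + 1) * a" by (simp only: distrib_right mult_1)
      then show ?thesis by simp
    qed
    ultimately show ?thesis by (simp only:)
  qed
  also have "\<dots> \<le> 4 * ennreal c"
    using bound by (intro mult_left_mono) (auto simp: \<psi>_def)
  also have "\<dots> = ennreal (4 * c)"
    using \<open>0 \<le> c\<close> by (simp add: ennreal_mult')
  finally have "enn2real (\<integral>\<^sup>+x. ennreal ((sqrt (p x) - sqrt (p (x - D)))\<^sup>2) \<partial>lborel) \<le> 4 * c"
    using \<open>0 \<le> c\<close> enn2real_mono[of _ "ennreal (4 * c)"] by fastforce
  then show ?thesis
    unfolding hellinger_sq_def by (subst integral_eq_nn_integral) auto
qed

text \<open>Multiply by \<open>(sqrt a + sqrt b)\<^sup>2\<close>, which is at least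
  \<open>a\<close>. One factor \<open>a - b\<close> is kept separate so that it can later be
  expanded over the components.\<close>

lemma sqrt_diff_sq_le:
  fixes a b :: real
  assumes "0 \<le> b" "b \<le> a"
  shows "(sqrt a - sqrt b)\<^sup>2 \<le> (a - b) * (a - b) / a"
proof (cases "a = 0")
  case False
  then have a: "0 < a" using assms by simp
  have "(sqrt a - sqrt b)\<^sup>2 * a \<le> (sqrt a - sqrt b)\<^sup>2 * (sqrt a + sqrt b)\<^sup>2"
    using assms a power_mono[of "sqrt a" "sqrt a + sqrt b" 2] by (intro mult_left_mono) auto
  also have "\<dots> = ((sqrt a - sqrt b) * (sqrt a + sqrt b))\<^sup>2" by (simp add: power_mult_distrib)
  also have "(sqrt a - sqrt b) * (sqrt a + sqrt b) = a - b"
    using assms a by (simp add: algebra_simps)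
  finally show ?thesis using a by (simp add: le_divide_eq power2_eq_square)
qed (use assms in auto)

section \<open>Mixtures of symmetric log-concave densities\<close>

locale slc_mixture =
  fixes k :: nat and w :: "nat \<Rightarrow> real" and q :: "nat \<Rightarrow> real \<Rightarrow> real"
  assumes w_nonneg: "i < k \<Longrightarrow> 0 \<le> w i" and w_sum: "(\<Sum>i<k. w i) = 1"
    and q_slc: "i < k \<Longrightarrow> sym_lc_density (q i)"
begin

abbreviation p where "p \<equiv> mixture k w q"

lemma p_measurable [measurable]: "p \<in> borel_measurable borel"
  unfolding mixture_def
proof (rule borel_measurable_sum)
  fix i assume "i \<in> {..<k}"
  then have [measurable]: "q i \<in> borel_measurable borel" using sym_lc_measurable[OF q_slc] by simp
  show "(\<lambda>x. w i * q i x) \<in> borel_measurable borel" by measurable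
qed

lemma p_nonneg: "0 \<le> p x"
  unfolding mixture_def by (auto intro!: sum_nonneg mult_nonneg_nonneg w_nonneg sym_lc_nonneg[OF q_slc])

lemma p_even: "p (- x) = p x"
  unfolding mixture_def using q_slc by (auto intro!: sum.cong simp: sym_lc_density_def)

lemma p_antimono: "0 \<le> x \<Longrightarrow> x \<le> y \<Longrightarrow> p y \<le> p x"
  unfolding mixture_def by (auto intro!: sum_mono mult_left_mono w_nonneg sym_lc_antimono[OF q_slc])

lemma p_integrable: "integrable lborel p"
  unfolding mixture_def using q_slc
  by (intro Bochner_Integration.integrable_sum integrable_mult_right) (auto simp: sym_lc_density_def)

lemma p_integral: "(\<integral>x. p x \<partial>lborel) = 1"
proof -
  have "(\<integral>x. p x \<partial>lborel) = (\<Sum>i<k. \<integral>x. w i * q i x \<partial>lborel)"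
    unfolding mixture_def using q_slc
    by (intro Bochner_Integration.integral_sum integrable_mult_right) (auto simp: sym_lc_density_def)
  also have "\<dots> = (\<Sum>i<k. w i)" using q_slc by (intro sum.cong) (auto simp: sym_lc_density_def)
  finally show ?thesis using w_sum by simp
qed

text \<open>Expanding one factor of \<open>p y - p (y + D)\<close> as the sum of the
  \<open>d i\<close> bounds the half-line integral by \<open>k\<close> integrals, each handled by
  \<open>component_bound\<close>. The cutoff \<open>N\<close> stays free here and becomes the sample
  size later.\<close>

lemma hellinger_sq_shift_le:
  assumes N: "1 \<le> N" and D: "0 \<le> D" and \<eta>: "0 \<le> \<eta>"
    and test: "\<And>a b. 0 \<le> a \<Longrightarrow> a < b \<Longrightarrow>
       (LINT y:{a..b}|lborel. p y - p (y + D))\<^sup>2 \<le> \<eta> * (LINT y:{a..b}|lborel. p y)"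
  shows "hellinger_sq p (\<lambda>x. p (x - D)) \<le> 2 * (real k * (3 / N + (5 * ln N + 1) * (exp 1 * \<eta>)))"
proof (rule hellinger_sq_le_half_line)
  let ?c = "3 / N + (5 * ln N + 1) * (exp 1 * \<eta>)"
  define d where "d i y = w i * (q i y - q i (y + D))" for i y
  have [measurable]: "d i \<in> borel_measurable borel" if "i < k" for i
    unfolding d_def using sym_lc_measurable[OF q_slc[OF that]] by measurable
  have c: "0 \<le> ?c" using N \<eta> by simp
  then show "0 \<le> real k * ?c" by simp
  have v: "p y - p (y + D) = (\<Sum>i<k. d i y)" for y
    by (simp add: mixture_def d_def sum_subtractf right_diff_distrib)
  have d0: "0 \<le> d i y" if "i < k" "0 \<le> y" for i y
    using sym_lc_antimono[OF q_slc[OF that(1)], of y "y + D"] that D w_nonneg by (simp add: d_def)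
  have w1: "w i \<le> 1" if "i < k" for i
    using member_le_sum[of i "{..<k}" w] that w_nonneg w_sum by simp
  have "(\<integral>\<^sup>+y\<in>{0..}. ennreal ((sqrt (p y) - sqrt (p (y + D)))\<^sup>2) \<partial>lborel)
    \<le> (\<integral>\<^sup>+y. (\<Sum>i<k. ennreal (d i y * (p y - p (y + D)) / p y) * indicator {0..} y) \<partial>lborel)"
  proof (rule nn_integral_mono)
    fix y
    show "ennreal ((sqrt (p y) - sqrt (p (y + D)))\<^sup>2) * indicator {0..} y
      \<le> (\<Sum>i<k. ennreal (d i y * (p y - p (y + D)) / p y) * indicator {0..} y)"
    proof (cases "0 \<le> y")
      case True
      have le: "p (y + D) \<le> p y" using p_antimono[of y "y + D"] True D by simp
      have "(sqrt (p y) - sqrt (p (y + D)))\<^sup>2 \<le> (p y - p (y + D)) * (p y - p (y + D)) / p y"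
        using le by (intro sqrt_diff_sq_le p_nonneg)
      also have "\<dots> = (\<Sum>i<k. d i y) * (p y - p (y + D)) / p y" by (simp add: v)
      also have "\<dots> = (\<Sum>i<k. d i y * (p y - p (y + D)) / p y)"
        by (simp add: sum_distrib_right sum_divide_distrib)
      finally have "ennreal ((sqrt (p y) - sqrt (p (y + D)))\<^sup>2) \<le> ennreal \<dots>" by (rule ennreal_leI)
      also have "\<dots> = (\<Sum>i<k. ennreal (d i y * (p y - p (y + D)) / p y))"
        using d0 True le p_nonneg by (intro sum_ennreal[symmetric]) auto
      finally show ?thesis using True by simp
    qed simp
  qed
  also have "\<dots> = (\<Sum>i<k. \<integral>\<^sup>+y\<in>{0..}. ennreal (d i y * (p y - p (y + D)) / p y) \<partial>lborel)"
    by (intro nn_integral_sum) auto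
  also have "\<dots> \<le> (\<Sum>i<k. ennreal ?c)"
  proof (rule sum_mono)
    fix i assume "i \<in> {..<k}"
    then have i: "i < k" by simp
    show "(\<integral>\<^sup>+y\<in>{0..}. ennreal (d i y * (p y - p (y + D)) / p y) \<partial>lborel) \<le> ennreal ?c"
    proof (rule component_bound[OF q_slc[OF i] w_nonneg[OF i] w1[OF i] N D \<eta>])
      show "d i y \<le> p y - p (y + D) \<and> p y - p (y + D) \<le> p y" if "0 \<le> y" for y
        unfolding v using member_le_sum[of i "{..<k}" "\<lambda>i. d i y"] i d0 that p_nonneg[of "y + D"] v[of y] by simp
    qed (use p_integrable p_integral p_nonneg p_antimono test in \<open>auto simp: d_def\<close>)
  qed
  also have "\<dots> = ennreal (real k * ?c)"
    using c by (simp add: ennreal_of_nat_eq_real_of_nat ennreal_mult')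
  finally show "(\<integral>\<^sup>+y\<in>{0..}. ennreal ((sqrt (p y) - sqrt (p (y + D)))\<^sup>2) \<partial>lborel) \<le> ennreal (real k * ?c)" .
qed (use p_even p_nonneg p_antimono D in auto)

end

section \<open>Uniform concentration of interval counts\<close>

lemma (in real_distribution) cdf_attains:
  assumes cont: "\<And>x. isCont (cdf M) x" and c: "0 < c" "c < 1"
  obtains t where "cdf M t = c"
proof -
  obtain a where a: "cdf M a < c"
    using order_tendstoD(2)[OF cdf_lim_at_bot c(1)] by (auto simp: eventually_at_bot_linorder)
  obtain b where b: "c < cdf M b"
    using order_tendstoD(1)[OF cdf_lim_at_top_prob c(2)] by (auto simp: eventually_at_top_linorder)
  have "a \<le> b" using a b cdf_nondecreasing[of b a] by linarith
  then have "\<exists>t. a \<le> t \<and> t \<le> b \<and> cdf M t = c"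
    using a b cont by (intro IVT) auto
  with that show ?thesis by blast
qed

lemma (in real_distribution) cdf_borel_measurable: "cdf M \<in> borel_measurable borel"
  using cdf_nondecreasing by (intro borel_measurable_mono monoI)

text \<open>Half of the probability integral transform: a level \<open>c' > c\<close> is attained at
  some \<open>t\<close>, and the event lies in \<open>{..t}\<close>. The lemma after it gives the
  other half, with levels approaching from below.\<close>

lemma (in real_distribution) prob_cdf_le:
  assumes cont: "\<And>x. isCont (cdf M) x" and c: "0 \<le> c"
  shows "prob {x. cdf M x \<le> c} \<le> c"
proof (rule dense_ge)
  fix c' assume c': "c < c'"
  show "prob {x. cdf M x \<le> c} \<le> c'"
  proof (cases "c' < 1")
    case True
    then obtain t where t: "cdf M t = c'" using cdf_attains[OF cont] c c' by (metis order_le_less_trans)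
    have "{x. cdf M x \<le> c} \<subseteq> {..t}"
    proof
      fix x assume "x \<in> {x. cdf M x \<le> c}"
      then show "x \<in> {..t}" using cdf_nondecreasing[of t x] t c' by (cases "t \<le> x") auto
    qed
    then have "prob {x. cdf M x \<le> c} \<le> prob {..t}" by (intro finite_measure_mono) auto
    then show ?thesis using t by (simp add: cdf_def2)
  qed (use prob_le_1[of "{x. cdf M x \<le> c}"] in linarith)
qed

lemma (in real_distribution) prob_cdf_less:
  assumes cont: "\<And>x. isCont (cdf M) x" and c: "c \<le> 1"
  shows "c \<le> prob {x. cdf M x < c}"
proof (rule dense_le)
  note [measurable] = cdf_borel_measurable
  fix c' assume c': "c' < c"
  show "c' \<le> prob {x. cdf M x < c}"
  proof (cases "0 < c'")
    case True
    then obtain t where t: "cdf M t = c'" using cdf_attains[OF cont] c c' by (metis order_less_le_trans)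
    have "{..t} \<subseteq> {x. cdf M x < c}"
    proof
      fix x assume "x \<in> {..t}"
      then show "x \<in> {x. cdf M x < c}" using cdf_nondecreasing[of x t] t c' by auto
    qed
    then have "prob {..t} \<le> prob {x. cdf M x < c}" by (intro finite_measure_mono) auto
    then show ?thesis using t by (simp add: cdf_def2)
  qed (use measure_nonneg[of M "{x. cdf M x < c}"] in linarith)
qed

section \<open>Chernoff bounds for counts of independent samples\<close>

definition hits :: "nat \<Rightarrow> 'a set \<Rightarrow> (nat \<Rightarrow> 'a) \<Rightarrow> real" where
  "hits n B X = real (card {i \<in> {..<n}. X i \<in> B})"

lemma hits_eq_sum: "hits n B X = (\<Sum>i<n. indicator B (X i))"
proof -
  have "(\<Sum>i<n. indicator B (X i) :: real) = (\<Sum>i \<in> {i \<in> {..<n}. X i \<in> B}. 1)"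
    by (intro sum.mono_neutral_cong_right) auto
  then show ?thesis by (simp add: hits_def)
qed

lemma hits_mono:
  assumes "\<And>x. x \<in> B \<Longrightarrow> x \<in> C"
  shows "hits n B X \<le> hits n C X"
  unfolding hits_def using assms by (intro of_nat_mono card_mono) auto

lemma hits_measurable [measurable]:
  assumes [measurable]: "B \<in> sets M"
  shows "hits n B \<in> borel_measurable (PiM {..<n} (\<lambda>_. M))"
  unfolding hits_eq_sum[abs_def] by measurable

text \<open>Exponential Markov inequality with parameter \<open>ln c\<close>, using independence and
  \<open>1 + x \<le> exp x\<close>. Multiplying by \<open>ln c\<close> and \<open>c - 1\<close>
  treats both tails at once: \<open>c > 1\<close> gives the upper tail with \<open>\<theta>\<close>
  above the mean, \<open>c < 1\<close> the lower tail with \<open>\<theta>\<close> below it.\<close>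

lemma (in prob_space) hits_exp_bound:
  assumes [measurable]: "B \<in> sets M" and c: "0 < c"
    and \<theta>: "(c - 1) * (real n * prob B) \<le> (c - 1) * \<theta>"
  shows "measure (PiM {..<n} (\<lambda>_. M))
      {X \<in> space (PiM {..<n} (\<lambda>_. M)). ln c * x \<le> ln c * hits n B X}
    \<le> exp (\<theta> * (c - 1) - ln c * x)"
proof -
  let ?P = "PiM {..<n} (\<lambda>_. M)"
  let ?E = "{X \<in> space ?P. ln c * x \<le> ln c * hits n B X}"
  define f where "f y = (if y \<in> B then c else 1)" for y
  have [measurable]: "f \<in> borel_measurable M" unfolding f_def by measurable
  have f0: "0 < f y" for y using c by (simp add: f_def)
  interpret prod: product_prob_space "\<lambda>_. M" "{..<n}" by unfold_locales
  have exp_hits: "exp (ln c * hits n B X) = (\<Prod>i<n. f (X i))" for X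
  proof -
    have "(\<Prod>i<n. f (X i)) = exp (\<Sum>i<n. ln c * indicator B (X i))"
      unfolding exp_sum[OF finite_lessThan] using c by (intro prod.cong) (auto simp: f_def indicator_def)
    then show ?thesis by (simp add: hits_eq_sum sum_distrib_left)
  qed
  have int_f: "(\<integral>\<^sup>+y. ennreal (f y) \<partial>M) = ennreal (1 + (c - 1) * prob B)"
  proof -
    have f_eq: "f y = 1 + (c - 1) * indicator B y" for y by (simp add: f_def indicator_def)
    have "(\<integral>\<^sup>+y. ennreal (f y) \<partial>M) = ennreal (\<integral>y. f y \<partial>M)"
    proof (rule nn_integral_eq_integral)
      show "integrable M f" unfolding f_eq[abs_def] by (simp add: emeasure_eq_measure)
    qed (use f0 less_imp_le in auto)
    also have "(\<integral>y. f y \<partial>M) = 1 + (c - 1) * prob B"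
      unfolding f_eq by (subst Bochner_Integration.integral_add) (auto simp: emeasure_eq_measure prob_space)
    finally show ?thesis .
  qed
  have b0: "0 \<le> 1 + (c - 1) * prob B"
  proof -
    have "(1 - c) * prob B \<le> 1 * 1" using c prob_le_1[of B] by (intro mult_mono) auto
    then show ?thesis by (simp add: algebra_simps)
  qed
  have "emeasure ?P ?E = (\<integral>\<^sup>+X. indicator ?E X \<partial>?P)" by simp
  also have "\<dots> \<le> (\<integral>\<^sup>+X. ennreal (exp (- ln c * x)) * (\<Prod>i<n. ennreal (f (X i))) \<partial>?P)"
  proof (rule nn_integral_mono)
    fix X
    have "1 \<le> ennreal (exp (- ln c * x)) * (\<Prod>i<n. ennreal (f (X i)))" if "X \<in> ?E"
    proof -
      have "1 \<le> exp (- ln c * x + ln c * hits n B X)" using that by simp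
      also have "\<dots> = exp (- ln c * x) * (\<Prod>i<n. f (X i))" by (simp only: exp_add exp_hits)
      finally have "ennreal 1 \<le> ennreal \<dots>" by (rule ennreal_leI)
      also have "\<dots> = ennreal (exp (- ln c * x)) * (\<Prod>i<n. ennreal (f (X i)))"
      proof -
        have "(\<Prod>i<n. ennreal (f (X i))) = ennreal (\<Prod>i<n. f (X i))"
          by (intro prod_ennreal) (rule less_imp_le[OF f0])
        then show ?thesis by (simp only: ennreal_mult' exp_ge_zero)
      qed
      finally show ?thesis by simp
    qed
    then show "indicator ?E X \<le> ennreal (exp (- ln c * x)) * (\<Prod>i<n. ennreal (f (X i)))"
      by (cases "X \<in> ?E") auto
  qed
  also have "\<dots> = ennreal (exp (- ln c * x)) * (\<integral>\<^sup>+X. (\<Prod>i<n. ennreal (f (X i))) \<partial>?P)"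
    by (intro nn_integral_cmult) measurable
  also have "(\<integral>\<^sup>+X. (\<Prod>i<n. ennreal (f (X i))) \<partial>?P) = (\<Prod>i<n. \<integral>\<^sup>+y. ennreal (f y) \<partial>M)"
    by (intro prod.product_nn_integral_prod) auto
  also have "\<dots> = ennreal ((1 + (c - 1) * prob B) ^ n)"
    using b0 by (simp add: int_f ennreal_power)
  also have "ennreal (exp (- ln c * x)) * \<dots> = ennreal (exp (- ln c * x) * (1 + (c - 1) * prob B) ^ n)"
    by (simp add: ennreal_mult')
  also have "\<dots> \<le> ennreal (exp (\<theta> * (c - 1) - ln c * x))"
  proof (rule ennreal_leI)
    have "(1 + (c - 1) * prob B) ^ n \<le> exp ((c - 1) * prob B) ^ n"
      using b0 by (intro power_mono) auto
    also have "\<dots> = exp ((c - 1) * (real n * prob B))" by (simp add: exp_of_nat_mult[symmetric] ac_simps)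
    also have "\<dots> \<le> exp ((c - 1) * \<theta>)" using \<theta> by simp
    finally have "exp (- ln c * x) * (1 + (c - 1) * prob B) ^ n \<le> exp (- ln c * x) * exp ((c - 1) * \<theta>)"
      by (intro mult_left_mono) auto
    also have "\<dots> = exp (\<theta> * (c - 1) - ln c * x)" by (simp add: exp_add[symmetric] ac_simps)
    finally show "exp (- ln c * x) * (1 + (c - 1) * prob B) ^ n \<le> exp (\<theta> * (c - 1) - ln c * x)" .
  qed
  finally show ?thesis unfolding prod.P.emeasure_eq_measure by simp
qed

text \<open>In square-root scale the deviation does not depend on the mean, which matches the form
  of the estimator's test.\<close>

lemma (in prob_space) hits_chernoff:
  assumes B: "B \<in> sets M" and \<theta>: "0 < \<theta>" and y: "0 < y"
  shows "real n * prob B \<le> \<theta> \<Longrightarrow> sqrt \<theta> \<le> y \<Longrightarrow>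
      measure (PiM {..<n} (\<lambda>_. M)) {X \<in> space (PiM {..<n} (\<lambda>_. M)). y\<^sup>2 \<le> hits n B X} \<le> exp (- (y - sqrt \<theta>)\<^sup>2)"
    and "\<theta> \<le> real n * prob B \<Longrightarrow> y \<le> sqrt \<theta> \<Longrightarrow>
      measure (PiM {..<n} (\<lambda>_. M)) {X \<in> space (PiM {..<n} (\<lambda>_. M)). hits n B X \<le> y\<^sup>2} \<le> exp (- (y - sqrt \<theta>)\<^sup>2)"
proof -
  let ?P = "PiM {..<n} (\<lambda>_. M)"
  note [measurable] = B
  interpret prod: product_prob_space "\<lambda>_. M" "{..<n}" by unfold_locales
  \<comment> \<open>The optimal choice would be \<open>y\<^sup>2 / \<theta>\<close>; its square root
    together with \<open>ln c \<ge> 1 - 1 / c\<close> makes the exponent exactly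
    \<open>- (y - sqrt \<theta>)\<^sup>2\<close>.\<close>
  define c where "c = y / sqrt \<theta>"
  have c: "0 < c" using \<theta> y by (simp add: c_def)
  have "1 - 1 / c \<le> ln c"
    using ln_le_minus_one[of "1 / c"] c by (simp add: ln_div)
  then have "y\<^sup>2 * (1 - 1 / c) \<le> y\<^sup>2 * ln c" by (intro mult_left_mono) auto
  moreover have "y\<^sup>2 * (1 - 1 / c) = y\<^sup>2 - y * sqrt \<theta>" using y \<theta> by (simp add: c_def field_simps power2_eq_square)
  moreover have "\<theta> * (c - 1) = y * sqrt \<theta> - \<theta>"
  proof -
    have "\<theta> / sqrt \<theta> = sqrt \<theta>" using \<theta> by (simp add: real_div_sqrt)
    then show ?thesis by (simp add: c_def right_diff_distrib) (metis mult.commute times_divide_eq_left)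
  qed
  ultimately have e: "\<theta> * (c - 1) - ln c * y\<^sup>2 \<le> - (y - sqrt \<theta>)\<^sup>2"
    using \<theta> by (simp add: power2_diff algebra_simps)
  have main: "measure ?P {X \<in> space ?P. Q X} \<le> exp (- (y - sqrt \<theta>)\<^sup>2)"
    if "(c - 1) * (real n * prob B) \<le> (c - 1) * \<theta>" "\<And>X. Q X \<Longrightarrow> ln c * y\<^sup>2 \<le> ln c * hits n B X" for Q
  proof -
    have "measure ?P {X \<in> space ?P. Q X} \<le> measure ?P {X \<in> space ?P. ln c * y\<^sup>2 \<le> ln c * hits n B X}"
      using that(2) by (intro prod.P.finite_measure_mono) auto
    also have "\<dots> \<le> exp (\<theta> * (c - 1) - ln c * y\<^sup>2)" by (rule hits_exp_bound[OF B c that(1)])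
    also have "\<dots> \<le> exp (- (y - sqrt \<theta>)\<^sup>2)" using e by simp
    finally show ?thesis .
  qed
  show "measure ?P {X \<in> space ?P. y\<^sup>2 \<le> hits n B X} \<le> exp (- (y - sqrt \<theta>)\<^sup>2)"
    if "real n * prob B \<le> \<theta>" "sqrt \<theta> \<le> y"
  proof -
    have "1 \<le> c" using that \<theta> by (simp add: c_def)
    then show ?thesis using that by (intro main mult_left_mono) auto
  qed
  show "measure ?P {X \<in> space ?P. hits n B X \<le> y\<^sup>2} \<le> exp (- (y - sqrt \<theta>)\<^sup>2)"
    if "\<theta> \<le> real n * prob B" "y \<le> sqrt \<theta>"
  proof -
    have "c \<le> 1" "ln c \<le> 0" using that \<theta> c by (auto simp: c_def)
    then show ?thesis using that by (intro main mult_left_mono_neg) auto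
  qed
qed

text \<open>Union bound over blocks between multiples of \<open>1 / n\<close> on the scale of the
  distribution function. An interval is enclosed in a closed block and, unless its expected count is
  at most 2, contains an open one. Their expected counts are within 2 of its own, whence the
  \<open>sqrt 2\<close>.\<close>

lemma (in real_distribution) interval_concentration:
  assumes cont: "\<And>x. isCont (cdf M) x" and n: "1 \<le> n" and T: "0 \<le> T"
  shows "\<exists>A \<in> sets (PiM {..<n} (\<lambda>_. M)).
    1 - 2 * (real n + 1) * (real n + 2) * exp (- T\<^sup>2) \<le> measure (PiM {..<n} (\<lambda>_. M)) A \<and>
    (\<forall>X\<in>A. \<forall>l r. l \<le> r \<longrightarrow>
      \<bar>sqrt (hits n {l..r} X) - sqrt (real n * (cdf M r - cdf M l))\<bar> \<le> T + sqrt 2)"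
proof -
  let ?P = "PiM {..<n} (\<lambda>_. M)" and ?F = "cdf M"
  note [measurable] = cdf_borel_measurable
  interpret prod: product_prob_space "\<lambda>_. M" "{..<n}" by unfold_locales
  define Bc where "Bc j k = {x. real j \<le> real n * ?F x \<and> real n * ?F x \<le> real k}" for j k
  define Bo where "Bo j k = {x. real j < real n * ?F x \<and> real n * ?F x < real k}" for j k
  have B_sets [measurable]: "Bc j k \<in> sets M" "Bo j k \<in> sets M" for j k
    unfolding Bc_def Bo_def by measurable
  have n0: "0 < real n" using n by simp
  have Bc: "real n * prob (Bc j k) \<le> real k - real j" if "j < k" "j \<le> n" for j k
  proof -
    have "Bc j k = {x. ?F x \<le> k / n} - {x. ?F x < j / n}"
      using n0 by (auto simp: Bc_def field_simps not_less)
    moreover have "{x. ?F x < j / n} \<subseteq> {x. ?F x \<le> k / n}"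
    proof safe
      fix x assume "?F x < j / n"
      also have "\<dots> \<le> k / n" using that by (intro divide_right_mono) auto
      finally show "?F x \<le> k / n" by simp
    qed
    ultimately have "prob (Bc j k) = prob {x. ?F x \<le> k / n} - prob {x. ?F x < j / n}"
      by (simp add: finite_measure_Diff)
    also have "\<dots> \<le> k / n - j / n"
      using that n0 by (intro diff_mono prob_cdf_le prob_cdf_less cont) auto
    finally show ?thesis using n0 by (simp add: field_simps)
  qed
  have Bo: "real k - real j \<le> real n * prob (Bo j k)" if "j < k" "k \<le> n" for j k
  proof -
    have "Bo j k = {x. ?F x < k / n} - {x. ?F x \<le> j / n}"
      using n0 by (auto simp: Bo_def field_simps not_less not_le)
    moreover have "{x. ?F x \<le> j / n} \<subseteq> {x. ?F x < k / n}"
    proof safe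
      fix x assume "?F x \<le> j / n"
      also have "\<dots> < k / n" using that n0 by (intro divide_strict_right_mono) auto
      finally show "?F x < k / n" by simp
    qed
    ultimately have "prob (Bo j k) = prob {x. ?F x < k / n} - prob {x. ?F x \<le> j / n}"
      by (simp add: finite_measure_Diff)
    moreover have "k / n - j / n \<le> prob {x. ?F x < k / n} - prob {x. ?F x \<le> j / n}"
      using that n0 by (intro diff_mono prob_cdf_le prob_cdf_less cont) auto
    ultimately have "real n * (k / n - j / n) \<le> real n * prob (Bo j k)"
      using n0 by (intro mult_left_mono) auto
    then show ?thesis using n0 by (simp add: right_diff_distrib)
  qed
  \<comment> \<open>The enclosing block of an interval reaching the top quantile ends at
    \<open>n + 1\<close>. The lower bound on the mass of an open block fails there, hence the
    conjunct \<open>k \<le> n\<close> in \<open>lo\<close>.\<close>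
  define I where "I = {(j, k). j < k \<and> j \<le> n \<and> k \<le> n + 1}"
  define up where "up j k = {X \<in> space ?P. sqrt (real k - real j) + T < sqrt (hits n (Bc j k) X)}" for j k
  define lo where "lo j k = {X \<in> space ?P. k \<le> n \<and> sqrt (hits n (Bo j k) X) < sqrt (real k - real j) - T}" for j k
  have [measurable]: "up j k \<in> sets ?P" "lo j k \<in> sets ?P" for j k
    unfolding up_def lo_def by measurable
  have up: "measure ?P (up j k) \<le> exp (- T\<^sup>2)" if jk: "j < k" "j \<le> n" for j k
  proof -
    let ?y = "sqrt (real k - real j) + T"
    have y: "0 < ?y" using jk T by (simp add: add_pos_nonneg)
    have "up j k \<subseteq> {X \<in> space ?P. ?y\<^sup>2 \<le> hits n (Bc j k) X}"
    proof
      fix X assume "X \<in> up j k"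
      then have "?y\<^sup>2 \<le> (sqrt (hits n (Bc j k) X))\<^sup>2" "X \<in> space ?P"
        using y by (auto simp: up_def intro!: power_mono)
      then show "X \<in> {X \<in> space ?P. ?y\<^sup>2 \<le> hits n (Bc j k) X}" by (simp add: hits_def)
    qed
    then have "measure ?P (up j k) \<le> measure ?P {X \<in> space ?P. ?y\<^sup>2 \<le> hits n (Bc j k) X}"
      by (intro prod.P.finite_measure_mono) auto
    also have "\<dots> \<le> exp (- (?y - sqrt (real k - real j))\<^sup>2)"
      using jk Bc[OF jk] T y by (intro hits_chernoff(1)[OF B_sets(1)]) auto
    finally show ?thesis by simp
  qed
  have lo: "measure ?P (lo j k) \<le> exp (- T\<^sup>2)" if jk: "j < k" for j k
  proof (cases "k \<le> n \<and> 0 < sqrt (real k - real j) - T")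
    case True
    let ?y = "sqrt (real k - real j) - T"
    have "lo j k \<subseteq> {X \<in> space ?P. hits n (Bo j k) X \<le> ?y\<^sup>2}"
    proof
      fix X assume "X \<in> lo j k"
      then have X: "sqrt (hits n (Bo j k) X) \<le> ?y" "X \<in> space ?P" by (auto simp: lo_def)
      then have "(sqrt (hits n (Bo j k) X))\<^sup>2 \<le> ?y\<^sup>2" by (intro power_mono) (simp_all add: hits_def)
      with X(2) show "X \<in> {X \<in> space ?P. hits n (Bo j k) X \<le> ?y\<^sup>2}" by (simp add: hits_def)
    qed
    then have "measure ?P (lo j k) \<le> measure ?P {X \<in> space ?P. hits n (Bo j k) X \<le> ?y\<^sup>2}"
      by (intro prod.P.finite_measure_mono) auto
    also have "\<dots> \<le> exp (- (?y - sqrt (real k - real j))\<^sup>2)"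
      using jk Bo[OF jk] T True by (intro hits_chernoff(2)[OF B_sets(2)]) auto
    finally show ?thesis by simp
  next
    case False
    have "0 \<le> sqrt (hits n (Bo j k) X)" for X by (simp add: hits_def)
    then have "\<not> (k \<le> n \<and> sqrt (hits n (Bo j k) X) < sqrt (real k - real j) - T)" for X
      using False by (meson le_less_trans)
    then have "lo j k = {}" unfolding lo_def by blast
    then show ?thesis by simp
  qed
  have finI: "finite I" "real (card I) \<le> (real n + 1) * (real n + 2)"
  proof -
    have sub: "I \<subseteq> {..n} \<times> {..n+1}" by (auto simp: I_def)
    then show "finite I" by (rule finite_subset) auto
    have "card I \<le> card ({..n} \<times> {..n+1})" using sub by (intro card_mono) auto
    then have "card I \<le> (n + 1) * (n + 2)" by (simp add: card_cartesian_product)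
    then have "real (card I) \<le> real ((n + 1) * (n + 2))" by (rule of_nat_mono)
    then show "real (card I) \<le> (real n + 1) * (real n + 2)" by (simp add: algebra_simps)
  qed
  define Bad where "Bad = (\<Union>(j, k)\<in>I. up j k \<union> lo j k)"
  have [measurable]: "Bad \<in> sets ?P" unfolding Bad_def using finI by (intro sets.finite_UN) auto
  have "measure ?P Bad \<le> (\<Sum>(j, k)\<in>I. measure ?P (up j k \<union> lo j k))"
    unfolding Bad_def case_prod_beta' using finI
    by (intro prod.P.finite_measure_subadditive_finite) auto
  also have "\<dots> \<le> (\<Sum>(j, k)\<in>I. 2 * exp (- T\<^sup>2))"
  proof (intro sum_mono, clarify)
    fix j k assume "(j, k) \<in> I"
    then have jk: "j < k" "j \<le> n" by (auto simp: I_def)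
    have "measure ?P (up j k \<union> lo j k) \<le> measure ?P (up j k) + measure ?P (lo j k)"
      by (intro measure_Un_le) auto
    also have "\<dots> \<le> 2 * exp (- T\<^sup>2)" using up[OF jk] lo[OF jk(1)] by simp
    finally show "measure ?P (up j k \<union> lo j k) \<le> 2 * exp (- T\<^sup>2)" .
  qed
  also have "\<dots> = real (card I) * (2 * exp (- T\<^sup>2))" by (simp add: case_prod_beta')
  also have "\<dots> \<le> (real n + 1) * (real n + 2) * (2 * exp (- T\<^sup>2))"
    using finI by (intro mult_right_mono) auto
  also have "\<dots> = 2 * (real n + 1) * (real n + 2) * exp (- T\<^sup>2)" by (simp only: ac_simps)
  finally have bad: "measure ?P Bad \<le> 2 * (real n + 1) * (real n + 2) * exp (- T\<^sup>2)" .
  show ?thesis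
  \<comment> \<open>The complement of a finite union is measurable, although the conclusion concerns
    all real intervals.\<close>
  proof (intro bexI[of _ "space ?P - Bad"] conjI ballI allI impI)
    show "space ?P - Bad \<in> sets ?P" by measurable
    show "1 - 2 * (real n + 1) * (real n + 2) * exp (- T\<^sup>2) \<le> measure ?P (space ?P - Bad)"
    proof -
      have "measure ?P (space ?P - Bad) = 1 - measure ?P Bad" by (rule prod.P.prob_compl) measurable
      with bad show ?thesis by linarith
    qed
    fix X l r assume X: "X \<in> space ?P - Bad" and lr: "l \<le> (r::real)"
    have noup: "sqrt (hits n (Bc j k) X) \<le> sqrt (real k - real j) + T" if "(j, k) \<in> I" for j k
      using X that by (force simp: Bad_def up_def)
    have nolo: "sqrt (real k - real j) - T \<le> sqrt (hits n (Bo j k) X)" if "(j, k) \<in> I" "k \<le> n" for j k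
      using X that by (force simp: Bad_def lo_def)
    let ?\<theta> = "real n * (?F r - ?F l)" and ?N = "hits n {l..r} X"
    have F: "0 \<le> ?F l" "?F l \<le> ?F r" "?F r \<le> 1"
      using cdf_nonneg cdf_nondecreasing[OF lr] cdf_bounded_prob by auto
    define j where "j = nat \<lfloor>real n * ?F l\<rfloor>"
    define k where "k = nat \<lfloor>real n * ?F r\<rfloor>"
    have F': "0 \<le> real n * ?F l" "real n * ?F l \<le> real n * ?F r" "real n * ?F r \<le> real n"
      using F n0 by (auto intro: mult_left_mono mult_left_le)
    have j: "real j \<le> real n * ?F l" "real n * ?F l < real j + 1"
      unfolding j_def using F' by linarith+
    have k: "real k \<le> real n * ?F r" "real n * ?F r < real k + 1"
      unfolding k_def using F' by linarith+
    have "real j < real k + 1" "real k \<le> real n" using j k F' by linarith+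
    then have jk: "j \<le> k" "k \<le> n" by auto
    have \<theta>: "?\<theta> = real n * ?F r - real n * ?F l" by (simp add: right_diff_distrib)
    have \<theta>0: "0 \<le> ?\<theta>" using \<theta> F' by linarith
    have "sqrt ?N \<le> sqrt (hits n (Bc j (k + 1)) X)"
    proof (intro real_sqrt_le_mono hits_mono)
      fix x assume "x \<in> {l..r}"
      then have "real n * ?F l \<le> real n * ?F x" "real n * ?F x \<le> real n * ?F r"
        by (auto intro!: mult_left_mono cdf_nondecreasing)
      then show "x \<in> Bc j (k + 1)" using j k by (simp add: Bc_def)
    qed
    also have "\<dots> \<le> sqrt (real (k + 1) - real j) + T" using jk by (intro noup) (auto simp: I_def)
    also have "sqrt (real (k + 1) - real j) \<le> sqrt (?\<theta> + 2)" using j k \<theta> by (intro real_sqrt_le_mono) simp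
    also have "\<dots> \<le> sqrt ?\<theta> + sqrt 2" using \<theta>0 by (intro sqrt_add_le_add_sqrt) auto
    finally have upper: "sqrt ?N \<le> sqrt ?\<theta> + (T + sqrt 2)" by simp
    \<comment> \<open>If no open block fits between \<open>j + 1\<close> and \<open>k\<close>, the
      expected count is at most 2 and the bound holds without any information on the sample.\<close>
    have lower: "sqrt ?\<theta> \<le> sqrt ?N + (T + sqrt 2)"
    proof (cases "j + 1 < k")
      case True
      have "sqrt ?\<theta> \<le> sqrt ((real k - real (j + 1)) + 2)" using j k \<theta> by (intro real_sqrt_le_mono) simp
      also have "\<dots> \<le> sqrt (real k - real (j + 1)) + sqrt 2" using True by (intro sqrt_add_le_add_sqrt) auto
      also have "sqrt (real k - real (j + 1)) - T \<le> sqrt (hits n (Bo (j + 1) k) X)"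
        using True jk by (intro nolo) (auto simp: I_def)
      then have "sqrt (real k - real (j + 1)) + sqrt 2 \<le> sqrt (hits n (Bo (j + 1) k) X) + (T + sqrt 2)" by linarith
      also have "sqrt (hits n (Bo (j + 1) k) X) \<le> sqrt ?N"
      proof (intro real_sqrt_le_mono hits_mono)
        fix x assume "x \<in> Bo (j + 1) k"
        then have "real n * ?F l < real n * ?F x" "real n * ?F x < real n * ?F r"
          using j k by (auto simp: Bo_def)
        then have "?F l < ?F x" "?F x < ?F r" using n0 by auto
        then have "\<not> x \<le> l" "\<not> r \<le> x" using cdf_nondecreasing[of x l] cdf_nondecreasing[of r x] by auto
        then show "x \<in> {l..r}" by simp
      qed
      finally show ?thesis by simp
    next
      case False
      then have "real k \<le> real j + 1" by simp
      then have "?\<theta> \<le> 2" using j k \<theta> by linarith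
      then have "sqrt ?\<theta> \<le> sqrt 2" by simp
      moreover have "0 \<le> sqrt ?N" by (simp add: hits_def)
      ultimately show ?thesis using T by linarith
    qed
    show "\<bar>sqrt ?N - sqrt ?\<theta>\<bar> \<le> T + sqrt 2" using upper lower by linarith
  qed
qed

section \<open>The estimator\<close>

lemma count_in_eq_hits: "real (count_in X n l r) = hits n {l..r} X"
  by (simp add: count_in_def hits_def)

context slc_mixture
begin

section \<open>Interval masses of the centered mixture\<close>

definition mass :: "real \<Rightarrow> real \<Rightarrow> real" where
  "mass a b = (LINT y:{a..b}|lborel. p y)"

lemma mass_integrable: "set_integrable lborel {a..b} p"
  using p_integrable unfolding set_integrable_def by (intro integrable_mult_indicator) auto

lemma mass_nonneg: "0 \<le> mass a b"
  unfolding mass_def set_lebesgue_integral_def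
  by (intro integral_nonneg_AE AE_I2) (simp add: p_nonneg)

lemma mass_shift: "(LINT y:{a..b}|lborel. p (y + s)) = mass (a + s) (b + s)"
proof -
  have "mass (a + s) (b + s) = (LINT y|lborel. indicator {a + s..b + s} (s + 1 * y) *\<^sub>R p (s + 1 * y))"
    unfolding mass_def set_lebesgue_integral_def
    by (subst lborel_integral_real_affine[of 1 _ s]) simp_all
  also have "\<dots> = (LINT y:{a..b}|lborel. p (y + s))"
    unfolding set_lebesgue_integral_def
    by (intro Bochner_Integration.integral_cong) (auto simp: indicator_def add.commute)
  finally show ?thesis by simp
qed

lemma mass_shift_integrable: "set_integrable lborel {a..b} (\<lambda>y. p (y + s))"
proof -
  have "integrable lborel (\<lambda>y. p (s + 1 * y))"
    by (subst lborel_integrable_real_affine_iff) (auto simp: p_integrable)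
  then have "integrable lborel (\<lambda>y. p (y + s))" by (simp add: add.commute)
  then show ?thesis unfolding set_integrable_def by (intro integrable_mult_indicator) auto
qed

lemma mass_reflect: "mass (- b) (- a) = mass a b"
proof -
  have "mass (- b) (- a) = (LINT y|lborel. indicator {- b..- a} (0 + (- 1) * y) *\<^sub>R p (0 + (- 1) * y))"
    unfolding mass_def set_lebesgue_integral_def
    by (subst lborel_integral_real_affine[of "- 1" _ 0]) simp_all
  also have "\<dots> = mass a b"
    unfolding mass_def set_lebesgue_integral_def
    by (intro Bochner_Integration.integral_cong) (auto simp: indicator_def p_even)
  finally show ?thesis .
qed

lemma mass_shift_le: "0 \<le> a \<Longrightarrow> 0 \<le> s \<Longrightarrow> mass (a + s) (b + s) \<le> mass a b"
  unfolding mass_shift[symmetric] unfolding mass_def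
  by (intro set_integral_mono mass_shift_integrable mass_integrable p_antimono) auto

section \<open>The law of one sample\<close>

definition loc_distr :: "real \<Rightarrow> real measure" where
  "loc_distr \<mu> = density lborel (\<lambda>x. ennreal (p (x - \<mu>)))"

lemma emeasure_loc_distr:
  assumes [measurable]: "A \<in> sets borel"
  shows "emeasure (loc_distr \<mu>) A = ennreal (LINT x:A|lborel. p (x - \<mu>))"
proof -
  have "integrable lborel (\<lambda>x. p (- \<mu> + 1 * x))"
    by (subst lborel_integrable_real_affine_iff) (auto simp: p_integrable)
  then have i: "integrable lborel (\<lambda>x. p (x - \<mu>))" by simp
  have "emeasure (loc_distr \<mu>) A = (\<integral>\<^sup>+x. ennreal (p (x - \<mu>)) * indicator A x \<partial>lborel)"
    unfolding loc_distr_def by (simp add: emeasure_density)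
  also have "\<dots> = (\<integral>\<^sup>+x. ennreal (indicator A x *\<^sub>R p (x - \<mu>)) \<partial>lborel)"
    by (intro nn_integral_cong) (auto simp: indicator_def)
  also have "\<dots> = ennreal (LINT x:A|lborel. p (x - \<mu>))"
    unfolding set_lebesgue_integral_def using i
    by (intro nn_integral_eq_integral integrable_mult_indicator) (auto simp: p_nonneg)
  finally show ?thesis .
qed

lemma real_distribution_loc_distr: "real_distribution (loc_distr \<mu>)"
proof -
  have "(\<integral>x. p (x - \<mu>) \<partial>lborel) = (\<integral>x. p (- \<mu> + 1 * x) \<partial>lborel)" by simp
  also have "\<dots> = 1" using lborel_integral_real_affine[of 1 p "- \<mu>"] p_integral by simp
  finally have "emeasure (loc_distr \<mu>) UNIV = 1"
    by (simp add: emeasure_loc_distr set_lebesgue_integral_def)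
  then have "prob_space (loc_distr \<mu>)"
    by (intro prob_spaceI) (simp add: loc_distr_def)
  then show ?thesis
    by (auto simp: real_distribution_def real_distribution_axioms_def loc_distr_def)
qed

lemma measure_loc_distr_singleton: "measure (loc_distr \<mu>) {x} = 0"
proof -
  have "(LINT y:{x}|lborel. p (y - \<mu>)) = 0"
    unfolding set_lebesgue_integral_def
    by (rule integral_eq_zero_AE, use AE_lborel_singleton[of x] in eventually_elim) auto
  then show ?thesis by (simp add: measure_def emeasure_loc_distr)
qed

lemma cdf_loc_distr_diff:
  assumes "l \<le> r"
  shows "cdf (loc_distr \<mu>) r - cdf (loc_distr \<mu>) l = mass (l - \<mu>) (r - \<mu>)"
proof -
  interpret real_distribution "loc_distr \<mu>" by (rule real_distribution_loc_distr)
  have "measure (loc_distr \<mu>) {l..r} = measure (loc_distr \<mu>) ({l} \<union> {l<..r})"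
    using assms by (intro arg_cong[where f = "measure _"]) auto
  also have "\<dots> = measure (loc_distr \<mu>) {l} + measure (loc_distr \<mu>) {l<..r}"
    by (intro finite_measure_Union) auto
  also have "\<dots> = cdf (loc_distr \<mu>) r - cdf (loc_distr \<mu>) l"
    using assms by (cases "l = r") (simp_all add: measure_loc_distr_singleton cdf_diff_eq)
  finally have "cdf (loc_distr \<mu>) r - cdf (loc_distr \<mu>) l = measure (loc_distr \<mu>) {l..r}" by simp
  also have "\<dots> = (LINT x:{l..r}|lborel. p (x + - \<mu>))"
    using mass_shift[of l r "- \<mu>"] mass_nonneg by (simp add: measure_def emeasure_loc_distr)
  also have "\<dots> = mass (l - \<mu>) (r - \<mu>)" by (subst mass_shift) simp
  finally show ?thesis .
qed

text \<open>The two intervals tested at \<open>\<mu>\<close> are mirror images with equal mass, so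
  both count roots are within \<open>K\<close> of the same number. Hence the estimator has an
  output.\<close>

lemma valid_output_center:
  assumes conc: "\<And>l r. l \<le> r \<Longrightarrow>
      \<bar>sqrt (hits n {l..r} X) - sqrt (real n * mass (l - \<mu>) (r - \<mu>))\<bar> \<le> K"
  shows "valid_output X n (2 * K) \<mu>"
  unfolding valid_output_def passes_test_def count_in_eq_hits
proof (intro allI impI, elim conjE)
  fix a b :: real assume ab: "0 \<le> a" "a < b"
  show "\<bar>sqrt (hits n {\<mu> - b..\<mu> - a} X) - sqrt (hits n {\<mu> + a..\<mu> + b} X)\<bar> \<le> 2 * K"
    using conc[of "\<mu> - b" "\<mu> - a"] conc[of "\<mu> + a" "\<mu> + b"] ab by (simp add: mass_reflect)
qed

text \<open>With \<open>h = \<bar>\<mu> - m\<bar>\<close>, the test at \<open>m\<close> on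
  \<open>[a + h, b + h]\<close> sees, relative to \<open>\<mu>\<close>, the interval
  \<open>[a, b]\<close> on one side and \<open>[a + 2 * h, b + 2 * h]\<close> on the other, up to
  reflection. Passing it puts the roots of \<open>n\<close> times the two masses within
  \<open>2 * K + K + K\<close>.\<close>

lemma valid_output_mass_test:
  assumes n: "1 \<le> n"
    and conc: "\<And>l r. l \<le> r \<Longrightarrow>
      \<bar>sqrt (hits n {l..r} X) - sqrt (real n * mass (l - \<mu>) (r - \<mu>))\<bar> \<le> K"
    and valid: "valid_output X n (2 * K) m" and ab: "0 \<le> a" "a < b"
  defines "s \<equiv> 2 * \<bar>\<mu> - m\<bar>"
  shows "(mass a b - mass (a + s) (b + s))\<^sup>2 \<le> 64 * K\<^sup>2 / real n * mass a b"
proof -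
  let ?G = "mass a b" and ?F = "mass (a + s) (b + s)"
  define h where "h = \<bar>\<mu> - m\<bar>"
  have s: "s = 2 * h" "0 \<le> h" by (auto simp: s_def h_def)
  have FG: "0 \<le> ?F" "?F \<le> ?G" using ab s by (auto simp: mass_nonneg mass_shift_le)
  have FG_test: "\<bar>sqrt (hits n {m - (b + h)..m - (a + h)} X) - sqrt (hits n {m + (a + h)..m + (b + h)} X)\<bar> \<le> 2 * K"
    using valid ab s unfolding valid_output_def passes_test_def count_in_eq_hits by simp
  have c: "\<bar>sqrt (hits n {m - (b + h)..m - (a + h)} X) - sqrt (real n * mass (m - (b + h) - \<mu>) (m - (a + h) - \<mu>))\<bar> \<le> K"
    "\<bar>sqrt (hits n {m + (a + h)..m + (b + h)} X) - sqrt (real n * mass (m + (a + h) - \<mu>) (m + (b + h) - \<mu>))\<bar> \<le> K"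
    using ab by (auto intro!: conc)
  have "\<bar>sqrt (real n * ?G) - sqrt (real n * ?F)\<bar> \<le> 4 * K"
  proof (cases "\<mu> \<le> m")
    case True
    then have "m - (b + h) - \<mu> = - b" "m - (a + h) - \<mu> = - a"
      "m + (a + h) - \<mu> = a + s" "m + (b + h) - \<mu> = b + s" by (auto simp: s h_def)
    then show ?thesis using c FG_test by (simp only: mass_reflect)
  next
    case False
    then have "m - (b + h) - \<mu> = - (b + s)" "m - (a + h) - \<mu> = - (a + s)"
      "m + (a + h) - \<mu> = a" "m + (b + h) - \<mu> = b" by (auto simp: s h_def)
    then show ?thesis using c FG_test by (simp only: mass_reflect)
  qed
  then have "(sqrt (real n * ?G) - sqrt (real n * ?F))\<^sup>2 \<le> (4 * K)\<^sup>2"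
    by (metis abs_ge_zero power2_abs power_mono)
  moreover have "sqrt (real n * ?G) - sqrt (real n * ?F) = sqrt (real n) * (sqrt ?G - sqrt ?F)"
    by (simp add: real_sqrt_mult right_diff_distrib)
  ultimately have "real n * (sqrt ?G - sqrt ?F)\<^sup>2 \<le> 16 * K\<^sup>2"
    by (simp add: power_mult_distrib)
  then have 1: "(sqrt ?G - sqrt ?F)\<^sup>2 \<le> 16 * K\<^sup>2 / real n"
    using n by (simp add: field_simps)
  have "?G - ?F = (sqrt ?G - sqrt ?F) * (sqrt ?G + sqrt ?F)"
    using FG by (simp add: algebra_simps)
  then have "(?G - ?F)\<^sup>2 = (sqrt ?G - sqrt ?F)\<^sup>2 * (sqrt ?G + sqrt ?F)\<^sup>2"
    by (simp only: power_mult_distrib)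
  \<comment> \<open>Since \<open>F \<le> G\<close>, the sum of the roots is at most
    \<open>2 * sqrt G\<close>, which turns 16 into 64.\<close>
  also have "\<dots> \<le> 16 * K\<^sup>2 / real n * (2 * sqrt ?G)\<^sup>2"
  proof (rule mult_mono[OF 1])
    have "sqrt ?F \<le> sqrt ?G" using FG by simp
    then show "(sqrt ?G + sqrt ?F)\<^sup>2 \<le> (2 * sqrt ?G)\<^sup>2" using FG by (intro power_mono) auto
  qed auto
  also have "\<dots> = 64 * K\<^sup>2 / real n * ?G" using FG by (simp add: power_mult_distrib)
  finally show ?thesis .
qed

section \<open>Constants and confidence level\<close>

lemma ln_bounds:
  assumes n: "1 \<le> n" and \<delta>: "0 < \<delta>" "\<delta> < 1"
  shows "2 / 3 \<le> ln (2 * real n)" "ln (2 * real n) \<le> ln (2 * real n / \<delta>)" "ln (real n) \<le> ln (2 * real n)"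
proof -
  have "ln 2 \<le> ln (2 * real n)" using n by simp
  then show "2 / 3 \<le> ln (2 * real n)" using ln2_ge_two_thirds by linarith
  have "2 * real n \<le> 2 * real n / \<delta>" using \<delta> by (simp add: le_divide_eq mult_left_le)
  then show "ln (2 * real n) \<le> ln (2 * real n / \<delta>)" using n by (intro ln_mono) auto
  show "ln (real n) \<le> ln (2 * real n)" using n by simp
qed

text \<open>The shift \<open>s = 2 * \<bar>\<mu> - m\<bar>\<close> has small Hellinger distance, so
  it belongs to the set whose supremum is the modulus. Halving gives the claim for
  \<open>\<bar>\<mu> - m\<bar>\<close>.\<close>

lemma modulus_bound:
  assumes n: "1 \<le> n" and \<delta>: "0 < \<delta>" "\<delta> < 1"
    and conc: "\<And>l r. l \<le> r \<Longrightarrow>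
      \<bar>sqrt (hits n {l..r} X) - sqrt (real n * mass (l - \<mu>) (r - \<mu>))\<bar> \<le> 5 * sqrt (ln (2 * real n / \<delta>))"
    and valid: "valid_output X n (10 * sqrt (ln (2 * real n / \<delta>))) m"
  shows "ereal \<bar>\<mu> - m\<bar> \<le>
    hellinger_modulus p (100000 * (real k / real n) * ln (2 * real n / \<delta>) * (ln (2 * real n))\<^sup>2) / 2"
proof -
  define L where "L = ln (2 * real n / \<delta>)"
  define l where "l = ln (2 * real n)"
  define s where "s = 2 * \<bar>\<mu> - m\<bar>"
  note lb = ln_bounds[OF n \<delta>, folded L_def l_def]
  have n0: "1 \<le> real n" using n by simp
  \<comment> \<open>This is \<open>64 * K\<^sup>2 / n\<close> with
    \<open>K = 5 * sqrt L\<close>.\<close>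
  let ?\<eta> = "1600 * L / real n"
  have "hellinger_sq p (\<lambda>x. p (x - s)) \<le> 2 * (real k * (3 / real n + (5 * ln (real n) + 1) * (exp 1 * ?\<eta>)))"
  proof (rule hellinger_sq_shift_le[OF n0])
    show "0 \<le> s" by (simp add: s_def)
    show "0 \<le> ?\<eta>" using lb by simp
    fix a b :: real assume ab: "0 \<le> a" "a < b"
    have "(mass a b - mass (a + s) (b + s))\<^sup>2 \<le> 64 * (5 * sqrt L)\<^sup>2 / real n * mass a b"
      unfolding s_def
      by (rule valid_output_mass_test[OF n _ _ ab, where X = X]) (use conc valid in \<open>auto simp: L_def\<close>)
    also have "64 * (5 * sqrt L)\<^sup>2 / real n = ?\<eta>" using lb by (simp add: power_mult_distrib)
    finally show "(LINT y:{a..b}|lborel. p y - p (y + s))\<^sup>2 \<le> ?\<eta> * (LINT y:{a..b}|lborel. p y)"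
      by (simp add: mass_def[symmetric] mass_shift set_integral_diff mass_integrable mass_shift_integrable)
  qed
  also have "\<dots> \<le> 100000 * (real k / real n) * L * l\<^sup>2"
  proof -
    have l1: "1 \<le> 3 / 2 * l" using lb by simp
    have L1: "1 \<le> 3 / 2 * L" using lb by linarith
    have ll: "l \<le> 3 / 2 * l\<^sup>2" using mult_right_mono[OF l1, of l] lb by (simp add: power2_eq_square)
    have Ll: "8 / 27 \<le> L * l\<^sup>2"
    proof -
      have "(2 / 3) * (2 / 3)\<^sup>2 \<le> L * l\<^sup>2" using lb by (intro mult_mono power_mono) auto
      then show ?thesis by (simp add: power2_eq_square)
    qed
    \<comment> \<open>From \<open>l \<ge> 2 / 3\<close>:
      \<open>5 * l + 1 \<le> 13 / 2 * l \<le> 39 / 4 * l\<^sup>2\<close>. The resulting total is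
      \<open>2 * 39 / 4 * 3 * 1600 = 93600\<close>, and \<open>L * l\<^sup>2 \<ge> 8 / 27\<close>
      absorbs the additive 6 in the remaining 6400.\<close>
    have "(5 * ln (real n) + 1) * (exp 1 * ?\<eta>) \<le> (39 / 4 * l\<^sup>2) * (3 * ?\<eta>)"
    proof (rule mult_mono)
      show "5 * ln (real n) + 1 \<le> 39 / 4 * l\<^sup>2" using lb l1 ll by linarith
      show "exp 1 * ?\<eta> \<le> 3 * ?\<eta>" using exp_le lb by (intro mult_right_mono) auto
    qed (use lb in auto)
    then have "2 * (real k * (3 / real n + (5 * ln (real n) + 1) * (exp 1 * ?\<eta>))) \<le>
      2 * (real k * (3 / real n + (39 / 4 * l\<^sup>2) * (3 * ?\<eta>)))"
      by (intro mult_left_mono add_left_mono) auto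
    also have "\<dots> = real k / real n * (6 + 93600 * (L * l\<^sup>2))"
      by (simp add: algebra_simps add_divide_distrib)
    also have "\<dots> \<le> real k / real n * (100000 * (L * l\<^sup>2))"
      using Ll by (intro mult_left_mono) auto
    finally show ?thesis by (simp add: ac_simps)
  qed
  finally have "ereal \<bar>s\<bar> \<le> hellinger_modulus p (100000 * (real k / real n) * L * l\<^sup>2)"
    unfolding hellinger_modulus_def by (intro Sup_upper imageI) simp
  then show ?thesis
    by (subst ereal_le_divide_pos) (auto simp: s_def L_def l_def)
qed

text \<open>The choice \<open>T = 3 * sqrt L\<close> makes \<open>exp (- T\<^sup>2)\<close> the
  ninth power of \<open>u = \<delta> / (2 * n)\<close>. Two factors \<open>u\<close> cancel the
  quadratic number of blocks and leave \<open>\<delta>\<^sup>2\<close>; the other seven absorb the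
  constant.\<close>

lemma sample_space_concentration:
  assumes n: "1 \<le> n" and \<delta>: "0 < \<delta>" "\<delta> < 1"
  obtains A where "A \<in> sets (sample_space p \<mu> n)" "1 - \<delta> \<le> measure (sample_space p \<mu> n) A"
    "\<forall>X\<in>A. \<forall>l r. l \<le> r \<longrightarrow>
      \<bar>sqrt (hits n {l..r} X) - sqrt (real n * mass (l - \<mu>) (r - \<mu>))\<bar> \<le> 5 * sqrt (ln (2 * real n / \<delta>))"
proof -
  define L where "L = ln (2 * real n / \<delta>)"
  note lb = ln_bounds[OF n \<delta>, folded L_def]
  interpret real_distribution "loc_distr \<mu>" by (rule real_distribution_loc_distr)
  have P: "sample_space p \<mu> n = PiM {..<n} (\<lambda>_. loc_distr \<mu>)"
    by (simp add: sample_space_def loc_distr_def)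
  have cont: "isCont (cdf (loc_distr \<mu>)) x" for x
    by (simp add: isCont_cdf measure_loc_distr_singleton)
  have L0: "2 / 3 \<le> L" using lb by linarith
  obtain A where A: "A \<in> sets (sample_space p \<mu> n)"
    "1 - 2 * (real n + 1) * (real n + 2) * exp (- (3 * sqrt L)\<^sup>2) \<le> measure (sample_space p \<mu> n) A"
    "\<And>X l r. X \<in> A \<Longrightarrow> l \<le> r \<Longrightarrow>
      \<bar>sqrt (hits n {l..r} X) - sqrt (real n * (cdf (loc_distr \<mu>) r - cdf (loc_distr \<mu>) l))\<bar> \<le> 3 * sqrt L + sqrt 2"
    using interval_concentration[OF cont n, of "3 * sqrt L"] L0 unfolding P by auto
  have "2 * (real n + 1) * (real n + 2) * exp (- (3 * sqrt L)\<^sup>2) \<le> \<delta>"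
  proof -
    define u where "u = \<delta> / (2 * real n)"
    have u: "0 < u" "u \<le> 1 / 2" "real n * u = \<delta> / 2" using n \<delta> by (auto simp: u_def field_simps)
    have "exp (- (3 * sqrt L)\<^sup>2) = exp (real 9 * - L)" using L0 by (simp add: power_mult_distrib)
    also have "\<dots> = exp (- L) ^ 9" by (rule exp_of_nat_mult)
    also have "exp (- L) = u" using n \<delta> by (simp add: L_def u_def exp_minus)
    finally have e: "exp (- (3 * sqrt L)\<^sup>2) = u ^ 9" .
    have "2 * (real n + 1) * (real n + 2) \<le> 2 * (2 * real n) * (3 * real n)"
      using n by (intro mult_mono) auto
    then have "2 * (real n + 1) * (real n + 2) * u ^ 9 \<le> 2 * (2 * real n) * (3 * real n) * u ^ 9"
      using u by (intro mult_right_mono) auto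
    also have "\<dots> = 12 * (real n * u)\<^sup>2 * u ^ 7"
      by (simp add: power2_eq_square eval_nat_numeral)
    also have "\<dots> = 3 * \<delta>\<^sup>2 * u ^ 7" by (simp add: u power2_eq_square)
    also have "\<dots> \<le> 3 * \<delta>\<^sup>2 * (1 / 2) ^ 7" using u by (intro mult_left_mono power_mono) auto
    also have "\<dots> \<le> \<delta>\<^sup>2" by (simp add: power_divide)
    also have "\<dots> \<le> \<delta>" using \<delta> by (simp add: power2_eq_square mult_left_le)
    finally show ?thesis by (simp only: e)
  qed
  then have m: "1 - \<delta> \<le> measure (sample_space p \<mu> n) A" using A(2) by linarith
  have T: "3 * sqrt L + sqrt 2 \<le> 5 * sqrt L"
  proof -
    \<comment> \<open>The grid error \<open>sqrt 2\<close> costs at most \<open>2 * sqrt L\<close>,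
      so the deviation is \<open>5 * sqrt L\<close> in total.\<close>
    have "sqrt 2 \<le> sqrt (4 * L)" using L0 by (intro real_sqrt_le_mono) simp
    then show ?thesis by (simp add: real_sqrt_mult)
  qed
  show thesis
  proof (rule that[OF A(1) m], fold L_def, intro ballI allI impI)
    fix X l r assume "X \<in> A" "l \<le> (r::real)"
    from A(3)[OF this] T
    show "\<bar>sqrt (hits n {l..r} X) - sqrt (real n * mass (l - \<mu>) (r - \<mu>))\<bar> \<le> 5 * sqrt L"
      unfolding cdf_loc_distr_diff[OF \<open>l \<le> r\<close>] by linarith
  qed
qed

end

theorem theorem2p20:
  shows "\<exists>C\<^sub>\<gamma> C\<^sub>d. C\<^sub>\<gamma> \<ge> 1 \<and> C\<^sub>d \<ge> 1 \<and>
    (\<forall>(k::nat) (w::nat \<Rightarrow> real) (q::nat \<Rightarrow> real \<Rightarrow> real) (\<mu>::real) (n::nat) (\<delta>::real).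
       (\<forall>i<k. 0 \<le> w i) \<longrightarrow> (\<Sum>i<k. w i) = 1 \<longrightarrow> (\<forall>i<k. sym_lc_density (q i)) \<longrightarrow>
       1 \<le> n \<longrightarrow> 0 < \<delta> \<longrightarrow> \<delta> < 1 \<longrightarrow>
       (let p = mixture k w q;
            M = sample_space p \<mu> n;
            \<gamma> = C\<^sub>\<gamma> * sqrt (ln (2 * real n / \<delta>));
            \<Delta>s = hellinger_modulus p
                   (C\<^sub>d * (real k / real n) * ln (2 * real n / \<delta>) * (ln (2 * real n))^2)
        in \<exists>A\<in>sets M. 1 - \<delta> \<le> measure M A \<and>
             (\<forall>X\<in>A. (\<exists>\<mu>h. valid_output X n \<gamma> \<mu>h) \<and>
                     (\<forall>\<mu>h. valid_output X n \<gamma> \<mu>h \<longrightarrow> ereal \<bar>\<mu> - \<mu>h\<bar> \<le> \<Delta>s / 2))))"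
\<comment> \<open>A test compares two counts, each with root deviation \<open>5 * sqrt ?L\<close>,
  hence 10; the second constant is that of \<open>modulus_bound\<close>.\<close>
proof (rule exI[of _ 10], rule exI[of _ 100000], intro conjI allI impI)
  fix k :: nat and w :: "nat \<Rightarrow> real" and q :: "nat \<Rightarrow> real \<Rightarrow> real" and \<mu> \<delta> :: real and n :: nat
  assume wq: "\<forall>i<k. 0 \<le> w i" "(\<Sum>i<k. w i) = 1" "\<forall>i<k. sym_lc_density (q i)"
    and n: "1 \<le> n" and \<delta>: "0 < \<delta>" "\<delta> < 1"
  interpret slc_mixture k w q by unfold_locales (use wq in blast)+
  let ?L = "ln (2 * real n / \<delta>)"
  obtain A where A: "A \<in> sets (sample_space p \<mu> n)" "1 - \<delta> \<le> measure (sample_space p \<mu> n) A"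
    and AX: "\<forall>X\<in>A. \<forall>l r. l \<le> r \<longrightarrow>
      \<bar>sqrt (hits n {l..r} X) - sqrt (real n * mass (l - \<mu>) (r - \<mu>))\<bar> \<le> 5 * sqrt ?L"
    by (rule sample_space_concentration[OF n \<delta>, of \<mu>]) (rule that)
  have conc: "\<bar>sqrt (hits n {l..r} X) - sqrt (real n * mass (l - \<mu>) (r - \<mu>))\<bar> \<le> 5 * sqrt ?L"
    if "X \<in> A" "l \<le> r" for X l r
    using AX that by simp
  have "\<exists>A\<in>sets (sample_space p \<mu> n). 1 - \<delta> \<le> measure (sample_space p \<mu> n) A \<and>
      (\<forall>X\<in>A. (\<exists>\<mu>h. valid_output X n (10 * sqrt ?L) \<mu>h) \<and>
        (\<forall>\<mu>h. valid_output X n (10 * sqrt ?L) \<mu>h \<longrightarrow> ereal \<bar>\<mu> - \<mu>h\<bar> \<le>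
          hellinger_modulus p (100000 * (real k / real n) * ?L * (ln (2 * real n))\<^sup>2) / 2))"
  proof (intro bexI[OF _ A(1)] conjI[OF A(2)] ballI conjI allI impI)
    fix X assume X: "X \<in> A"
    show "\<exists>\<mu>h. valid_output X n (10 * sqrt ?L) \<mu>h"
    proof
      show "valid_output X n (10 * sqrt ?L) \<mu>"
        using valid_output_center[OF conc[OF X]] by simp
    qed
    show "ereal \<bar>\<mu> - m\<bar> \<le> hellinger_modulus p (100000 * (real k / real n) * ?L * (ln (2 * real n))\<^sup>2) / 2"
      if "valid_output X n (10 * sqrt ?L) m" for m
      by (rule modulus_bound[OF n \<delta> conc[OF X] that])
  qed
  then show "let p = mixture k w q;
            M = sample_space p \<mu> n;
            \<gamma> = 10 * sqrt (ln (2 * real n / \<delta>));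
            \<Delta>s = hellinger_modulus p
                   (100000 * (real k / real n) * ln (2 * real n / \<delta>) * (ln (2 * real n))^2)
        in \<exists>A\<in>sets M. 1 - \<delta> \<le> measure M A \<and>
             (\<forall>X\<in>A. (\<exists>\<mu>h. valid_output X n \<gamma> \<mu>h) \<and>
                     (\<forall>\<mu>h. valid_output X n \<gamma> \<mu>h \<longrightarrow> ereal \<bar>\<mu> - \<mu>h\<bar> \<le> \<Delta>s / 2))"
    by (simp only: Let_def)
qed simp_all

end
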